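(* Let $\ell:\langle\Pi_{\mathbb{Q}}\rangle\to\mathbb{R}$ be a linear functional which is continuous with respect to the $L^1(\mathbb{W})$-norm and satisfies $\ell(1)=1$. Suppose there exists some real $c>0$ such that for all $g(\vec b)\in\langle\Pi_{\mathbb{Q}}\rangle$, $$n\cdot\max_{0\le k<n}\left|\ell\left(g(\vec b)^2\cdot\left|b_{\frac{k+1}{n}}-b_{\frac{k}{n}}\right|^2\right)-\frac{c}{n}\cdot\ell\left(g(\vec b)^2\right)\right|\longrightarrow 0\quad\text{as } n\to\infty .$$ Let $f_1(\vec b),\dots,f_m(\vec b)\in\langle\Pi_{\mathbb{Q}}\rangle$ and assume, in addition, that $\ell\left(g(\vec b)^2\cdot\prod_{i=1}^m f_i(\vec b)^{k_i}\right)\ge 0$ for all $(k_1,\dots,k_m)\in\{0,1\}^m$ and all $g(\vec b)\in\langle\Pi_{\mathbb{Q}}\rangle$. Then there exist an adapted (i.e. filtered) probability space $\left(\Gamma,(\mathcal{G}_t)_{t\in[0,1]},\gamma\right)$ and a process $(\tilde b_t)_{t\in[0,1]}$ with continuous paths defined on $\Gamma$ such that $\tilde b$ is a Brownian motion with respect to some measure $\eta$ on $\Gamma$, and such that (i) $f_i\left((c\cdot\tilde b_t)_{t\in(0,1]}\right)\ge 0$ $\gamma$-almost surely for all $i\in\{1,\dots,m\}$, and (ii) $\ell\left(p(\vec b)\right)=\mathbb{E}_\gamma\left[p\left((c\cdot\tilde b_t)_{t\in(0,1]}\right)\right]$ for all $p(\vec b)\in\langle\Pi_{\mathbb{Q}}\rangle$.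 Moreover, there is a unique linear $L^1(\mathbb{W})$-continuous extension of $\ell$ to $\langle\Pi_{\mathbb{R}}\rangle$.
   Context: Let $\Omega=\{\omega\in C^0([0,1],\mathbb{R}) : \omega(0)=0\}$, let $\mathbb{W}$ be the Wiener measure on $\Omega$, and let $b_t:\Omega\to\mathbb{R}$, $b_t(\omega)=\omega(t)$ for $t\in[0,1]$ (so $b_0=0$). Let $$\Pi_{\mathbb{Q}}=\left\{\prod_{j=1}^m b_{q_j}^{i_j} : m\in\mathbb{N}_0,\ i_1,\dots,i_m\in\mathbb{N},\ q_1,\dots,q_m\in\mathbb{Q}\cap(0,1]\right\},$$ $$\Pi_{\mathbb{R}}=\left\{\prod_{j=1}^m b_{t_j}^{i_j} : m\in\mathbb{N}_0,\ i_1,\dots,i_m\in\mathbb{N},\ t_1,\dots,t_m\in(0,1]\right\},$$ and let $\langle\Pi_{\mathbb{Q}}\rangle$, $\langle\Pi_{\mathbb{R}}\rangle$ be the real vector spaces of random variables on $\Omega$ spanned by $\Pi_{\mathbb{Q}}$ and $\Pi_{\mathbb{R}}$ (polynomials of Brownian motion at rational, respectively arbitrary, times). An element is written $p(\vec b)$, where $p$ is the corresponding real polynomial in finitely many variables $X_t$; if $p(\vec b)=\sum_k a_k\prod_{j} b_{t_j(k)}^{i_j(k)}$ and $\vec y=(y_t)_{t\in(0,1]}$ is a real-valued family, then $p(\vec y)=\sum_k a_k\prod_j y_{t_j(k)}^{i_j(k)}$. *)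

theory Defs
  imports "HOL-Probability.Probability" "HOL-Library.Poly_Mapping"
begin

subsection \<open>Brownian motion and Wiener measure on the unit time interval\<close>

definition filtered_prob_space :: "'a measure \<Rightarrow> (real \<Rightarrow> 'a measure) \<Rightarrow> bool" where
  "filtered_prob_space M F \<longleftrightarrow>
     prob_space M \<and>
     (\<forall>t\<in>{0..1}. subalgebra M (F t)) \<and>
     (\<forall>s\<in>{0..1}. \<forall>t\<in>{0..1}. s \<le> t \<longrightarrow> subalgebra (F t) (F s))"

text \<open>Standard one-dimensional Brownian motion relative to the filtration \<^term>\<open>F\<close>; only the
  values of \<^term>\<open>F\<close> and \<^term>\<open>X\<close> at times in \<^term>\<open>{0..1::real}\<close> matter.\<close>

definition brownian_motion ::
    "'a measure \<Rightarrow> (real \<Rightarrow> 'a measure) \<Rightarrow> (real \<Rightarrow> 'a \<Rightarrow> real) \<Rightarrow> bool" where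
  "brownian_motion M F X \<longleftrightarrow>
     filtered_prob_space M F \<and>
     (\<forall>t\<in>{0..1}. X t \<in> borel_measurable (F t)) \<and>
     (AE x in M. X 0 x = 0) \<and>
     (AE x in M. continuous_on {0..1} (\<lambda>t. X t x)) \<and>
     (\<forall>s t. 0 \<le> s \<and> s < t \<and> t \<le> 1 \<longrightarrow>
        distributed M lborel (\<lambda>x. X t x - X s x) (normal_density 0 (sqrt (t - s))) \<and>
        prob_space.indep_set M (sets (F s))
          (sets (vimage_algebra (space M) (\<lambda>x. X t x - X s x) borel)))"

text \<open>A path on \<^term>\<open>{0..1::real}\<close> is represented by its unique extension to \<^typ>\<open>real\<close> that is
  \<^term>\<open>undefined\<close> outside of the interval.\<close>

definition Omega :: "(real \<Rightarrow> real) set" where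
  "Omega = {\<omega> \<in> extensional {0..1}. continuous_on {0..1} \<omega> \<and> \<omega> 0 = 0}"

definition coord_filtration :: "real \<Rightarrow> (real \<Rightarrow> real) measure" where
  "coord_filtration t =
     sigma Omega {(\<lambda>\<omega>. \<omega> s) -` B \<inter> Omega | s B. s \<in> {0..t} \<and> B \<in> sets borel}"

text \<open>The \<open>\<sigma>\<close>-algebra of \<^term>\<open>coord_filtration 1\<close> is generated by all coordinates, hence it is
  the Borel \<open>\<sigma>\<close>-algebra of the supremum norm on \<^term>\<open>Omega\<close>. The predicate below determines
  the measure uniquely.\<close>

definition wiener_measure :: "(real \<Rightarrow> real) measure \<Rightarrow> bool" where
  "wiener_measure W \<longleftrightarrow>
     sets W = sets (coord_filtration 1) \<and>
     brownian_motion W coord_filtration (\<lambda>t \<omega>. \<omega> t)"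


subsection \<open>Polynomials of Brownian motion\<close>

text \<open>Random variables on \<^term>\<open>Omega\<close> are represented by functions that are
  \<^term>\<open>undefined\<close> outside of \<^term>\<open>Omega\<close>. In particular, the value of every path at
  time \<open>0\<close> is the zero random variable.\<close>

definition bm_products :: "real set \<Rightarrow> ((real \<Rightarrow> real) \<Rightarrow> real) set" where
  "bm_products T =
     {(\<lambda>\<omega>\<in>Omega. \<Prod>j=1..m. \<omega> (q j) ^ i j) | (m::nat) (i::nat \<Rightarrow> nat) (q::nat \<Rightarrow> real).
        \<forall>j\<in>{1..m}. 0 < i j \<and> q j \<in> T}"

definition rv_span :: "((real \<Rightarrow> real) \<Rightarrow> real) set \<Rightarrow> ((real \<Rightarrow> real) \<Rightarrow> real) set" where
  "rv_span P =
     {(\<lambda>\<omega>\<in>Omega. \<Sum>k<n. a k * h k \<omega>) | (n::nat) (a::nat \<Rightarrow> real) h. \<forall>k<n. h k \<in> P}"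

definition rational_bm_polys :: "((real \<Rightarrow> real) \<Rightarrow> real) set" where
  "rational_bm_polys = rv_span (bm_products (\<rat> \<inter> {0<..1}))"

definition real_bm_polys :: "((real \<Rightarrow> real) \<Rightarrow> real) set" where
  "real_bm_polys = rv_span (bm_products {0<..1})"

text \<open>Formal real polynomials in variables indexed by reals: finitely supported families of
  coefficients indexed by exponent vectors of finite support.\<close>

type_synonym time_poly = "(real \<Rightarrow>\<^sub>0 nat) \<Rightarrow>\<^sub>0 real"

definition poly_times :: "time_poly \<Rightarrow> real set" where
  "poly_times p = (\<Union>\<alpha>\<in>Poly_Mapping.keys p. Poly_Mapping.keys \<alpha>)"

definition poly_eval :: "time_poly \<Rightarrow> (real \<Rightarrow> real) \<Rightarrow> real" where
  "poly_eval p y =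
     (\<Sum>\<alpha>\<in>Poly_Mapping.keys p. Poly_Mapping.lookup p \<alpha> *
        (\<Prod>t\<in>Poly_Mapping.keys \<alpha>. y t ^ Poly_Mapping.lookup \<alpha> t))"

definition bm_poly :: "time_poly \<Rightarrow> (real \<Rightarrow> real) \<Rightarrow> real" where
  "bm_poly p = (\<lambda>\<omega>\<in>Omega. poly_eval p \<omega>)"


subsection \<open>Functionals on spaces of random variables\<close>

definition linear_functional_on ::
    "((real \<Rightarrow> real) \<Rightarrow> real) set \<Rightarrow> (((real \<Rightarrow> real) \<Rightarrow> real) \<Rightarrow> real) \<Rightarrow> bool" where
  "linear_functional_on V L \<longleftrightarrow>
     (\<forall>f\<in>V. \<forall>g\<in>V. L (\<lambda>\<omega>\<in>Omega. f \<omega> + g \<omega>) = L f + L g) \<and>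
     (\<forall>a::real. \<forall>f\<in>V. L (\<lambda>\<omega>\<in>Omega. a * f \<omega>) = a * L f)"

definition L1_continuous_on ::
    "(real \<Rightarrow> real) measure \<Rightarrow> ((real \<Rightarrow> real) \<Rightarrow> real) set \<Rightarrow>
     (((real \<Rightarrow> real) \<Rightarrow> real) \<Rightarrow> real) \<Rightarrow> bool" where
  "L1_continuous_on W V L \<longleftrightarrow>
     (\<forall>f\<in>V. \<forall>e>0. \<exists>d>0. \<forall>g\<in>V. (\<integral>\<omega>. \<bar>g \<omega> - f \<omega>\<bar> \<partial>W) < d \<longrightarrow> \<bar>L g - L f\<bar> < e)"


subsection \<open>The spanned spaces consist of the evaluations of formal polynomials\<close>

definition mono_eval :: "(real \<Rightarrow>\<^sub>0 nat) \<Rightarrow> (real \<Rightarrow> real) \<Rightarrow> real" where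
  "mono_eval \<alpha> y = (\<Prod>t\<in>Poly_Mapping.keys \<alpha>. y t ^ Poly_Mapping.lookup \<alpha> t)"

lemma mono_eval_superset:
  assumes "finite S" "Poly_Mapping.keys \<alpha> \<subseteq> S"
  shows "mono_eval \<alpha> y = (\<Prod>t\<in>S. y t ^ Poly_Mapping.lookup \<alpha> t)"
  unfolding mono_eval_def
  by (rule prod.mono_neutral_left) (use assms in \<open>auto simp: in_keys_iff\<close>)

lemma mono_eval_add: "mono_eval (\<alpha> + \<beta>) y = mono_eval \<alpha> y * mono_eval \<beta> y"
proof -
  let ?S = "Poly_Mapping.keys \<alpha> \<union> Poly_Mapping.keys \<beta>"
  have "mono_eval (\<alpha> + \<beta>) y = (\<Prod>t\<in>?S. y t ^ Poly_Mapping.lookup (\<alpha> + \<beta>) t)"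
    by (rule mono_eval_superset[OF _ Poly_Mapping.keys_add]) simp
  moreover have "mono_eval \<alpha> y = (\<Prod>t\<in>?S. y t ^ Poly_Mapping.lookup \<alpha> t)"
    by (rule mono_eval_superset) auto
  moreover have "mono_eval \<beta> y = (\<Prod>t\<in>?S. y t ^ Poly_Mapping.lookup \<beta> t)"
    by (rule mono_eval_superset) auto
  ultimately show ?thesis
    by (simp add: lookup_add power_add prod.distrib)
qed

lemma poly_eval_superset:
  assumes "finite S" "Poly_Mapping.keys p \<subseteq> S"
  shows "poly_eval p y = (\<Sum>\<alpha>\<in>S. Poly_Mapping.lookup p \<alpha> * mono_eval \<alpha> y)"
  unfolding poly_eval_def mono_eval_def
  by (rule sum.mono_neutral_left) (use assms in \<open>auto simp: in_keys_iff\<close>)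

lemma poly_eval_add: "poly_eval (p + q) y = poly_eval p y + poly_eval q y"
proof -
  let ?S = "Poly_Mapping.keys p \<union> Poly_Mapping.keys q"
  have "poly_eval (p + q) y = (\<Sum>\<alpha>\<in>?S. Poly_Mapping.lookup (p + q) \<alpha> * mono_eval \<alpha> y)"
    by (rule poly_eval_superset[OF _ Poly_Mapping.keys_add]) simp
  moreover have "poly_eval p y = (\<Sum>\<alpha>\<in>?S. Poly_Mapping.lookup p \<alpha> * mono_eval \<alpha> y)"
    by (rule poly_eval_superset) auto
  moreover have "poly_eval q y = (\<Sum>\<alpha>\<in>?S. Poly_Mapping.lookup q \<alpha> * mono_eval \<alpha> y)"
    by (rule poly_eval_superset) auto
  ultimately show ?thesis
    by (simp add: lookup_add algebra_simps sum.distrib)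
qed

lemma poly_eval_single: "poly_eval (Poly_Mapping.single \<alpha> a) y = a * mono_eval \<alpha> y"
  by (subst poly_eval_superset[of "{\<alpha>}"]) (auto simp: lookup_single)

lemma bm_product_monomial:
  assumes "\<forall>j\<in>{1..m::nat}. q j \<in> T"
  shows "\<exists>\<alpha>. Poly_Mapping.keys \<alpha> \<subseteq> T \<and> (\<forall>y. mono_eval \<alpha> y = (\<Prod>j=1..m. y (q j) ^ i j))"
  using assms
proof (induction m)
  case 0
  show ?case by (rule exI[of _ 0]) (auto simp: mono_eval_def)
next
  case (Suc m)
  then obtain \<alpha> where a: "Poly_Mapping.keys \<alpha> \<subseteq> T"
      "\<And>y. mono_eval \<alpha> y = (\<Prod>j=1..m. y (q j) ^ i j)"
    by fastforce
  let ?b = "Poly_Mapping.single (q (Suc m)) (i (Suc m))"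
  have "mono_eval ?b y = y (q (Suc m)) ^ i (Suc m)" for y
    by (subst mono_eval_superset[of "{q (Suc m)}"]) (auto split: if_splits)
  moreover have "Poly_Mapping.keys ?b \<subseteq> T"
    using Suc.prems by auto
  ultimately show ?case
    using a Poly_Mapping.keys_add[of \<alpha> ?b]
    by (intro exI[of _ "\<alpha> + ?b"]) (auto simp: mono_eval_add)
qed

lemma mono_eval_in_bm_products:
  assumes "Poly_Mapping.keys \<alpha> \<subseteq> T"
  shows "(\<lambda>\<omega>\<in>Omega. mono_eval \<alpha> \<omega>) \<in> bm_products T"
proof -
  obtain q where q: "bij_betw q {1..card (Poly_Mapping.keys \<alpha>)} (Poly_Mapping.keys \<alpha>)"
    using ex_bij_betw_nat_finite_1[OF Poly_Mapping.finite_keys] by blast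
  have "mono_eval \<alpha> y =
      (\<Prod>j=1..card (Poly_Mapping.keys \<alpha>). y (q j) ^ Poly_Mapping.lookup \<alpha> (q j))" for y
    unfolding mono_eval_def by (rule prod.reindex_bij_betw[OF q, symmetric])
  moreover have "\<forall>j\<in>{1..card (Poly_Mapping.keys \<alpha>)}.
      0 < Poly_Mapping.lookup \<alpha> (q j) \<and> q j \<in> T"
    using bij_betwE[OF q] assms by (auto simp: in_keys_iff)
  ultimately show ?thesis
    unfolding bm_products_def mem_Collect_eq
    by (intro exI[of _ "card (Poly_Mapping.keys \<alpha>)"]
        exI[of _ "\<lambda>j. Poly_Mapping.lookup \<alpha> (q j)"] exI[of _ q] conjI restrict_ext) auto
qed

theorem rv_span_bm_products:
  "rv_span (bm_products T) = bm_poly ` {p. poly_times p \<subseteq> T}"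
proof (intro equalityI subsetI)
  fix f assume "f \<in> rv_span (bm_products T)"
  then obtain n a h where f: "f = (\<lambda>\<omega>\<in>Omega. \<Sum>k<n. a k * h k \<omega>)"
    and h: "\<forall>k<n::nat. h k \<in> bm_products T"
    unfolding rv_span_def by blast
  have "\<exists>p. poly_times p \<subseteq> T \<and> (\<forall>\<omega>\<in>Omega. poly_eval p \<omega> = (\<Sum>k<n. a k * h k \<omega>))"
    using h
  proof (induction n)
    case 0
    show ?case by (rule exI[of _ 0]) (auto simp: poly_times_def poly_eval_def)
  next
    case (Suc n)
    then obtain p where p: "poly_times p \<subseteq> T"
        "\<And>\<omega>. \<omega> \<in> Omega \<Longrightarrow> poly_eval p \<omega> = (\<Sum>k<n. a k * h k \<omega>)"
      by auto
    from Suc.prems obtain m i q where "h n = (\<lambda>\<omega>\<in>Omega. \<Prod>j=1..m. \<omega> (q j) ^ i j)"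
      and "\<forall>j\<in>{1..m::nat}. q j \<in> T"
      unfolding bm_products_def by blast
    with bm_product_monomial[of m q T i] obtain \<alpha> where \<alpha>: "Poly_Mapping.keys \<alpha> \<subseteq> T"
        "\<And>\<omega>. \<omega> \<in> Omega \<Longrightarrow> h n \<omega> = mono_eval \<alpha> \<omega>"
      by auto
    let ?p = "p + Poly_Mapping.single \<alpha> (a n)"
    have "poly_times ?p \<subseteq> T"
    proof -
      have "Poly_Mapping.keys ?p \<subseteq> insert \<alpha> (Poly_Mapping.keys p)"
        using Poly_Mapping.keys_add[of p "Poly_Mapping.single \<alpha> (a n)"]
        by (simp split: if_splits) blast
      then show ?thesis
        using p(1) \<alpha>(1) unfolding poly_times_def by blast
    qed
    then show ?case
      by (intro exI[of _ ?p]) (simp add: poly_eval_add poly_eval_single p(2) \<alpha>(2))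
  qed
  then obtain p where "poly_times p \<subseteq> T" "\<forall>\<omega>\<in>Omega. poly_eval p \<omega> = (\<Sum>k<n. a k * h k \<omega>)"
    by blast
  then show "f \<in> bm_poly ` {p. poly_times p \<subseteq> T}"
    by (intro image_eqI[of _ _ p]) (auto simp: f bm_poly_def restrict_def)
next
  fix f assume "f \<in> bm_poly ` {p. poly_times p \<subseteq> T}"
  then obtain p where p: "poly_times p \<subseteq> T" and f: "f = bm_poly p"
    by blast
  obtain e where e: "bij_betw e {..<card (Poly_Mapping.keys p)} (Poly_Mapping.keys p)"
    using ex_bij_betw_nat_finite[OF Poly_Mapping.finite_keys[of p]]
    by (auto simp: atLeast0LessThan)
  have "f = (\<lambda>\<omega>\<in>Omega. \<Sum>k<card (Poly_Mapping.keys p).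
      Poly_Mapping.lookup p (e k) * (\<lambda>\<omega>\<in>Omega. mono_eval (e k) \<omega>) \<omega>)"
    unfolding f bm_poly_def poly_eval_def
    by (auto simp: mono_eval_def sum.reindex_bij_betw[OF e, symmetric] restrict_def)
  moreover have "\<forall>k<card (Poly_Mapping.keys p).
      (\<lambda>\<omega>\<in>Omega. mono_eval (e k) \<omega>) \<in> bm_products T"
    using p bij_betwE[OF e] by (auto simp: poly_times_def intro!: mono_eval_in_bm_products)
  ultimately show "f \<in> rv_span (bm_products T)"
    unfolding rv_span_def mem_Collect_eq
    by (intro exI[of _ "card (Poly_Mapping.keys p)"]
        exI[of _ "\<lambda>k. Poly_Mapping.lookup p (e k)"]
        exI[of _ "\<lambda>k. (\<lambda>\<omega>\<in>Omega. mono_eval (e k) \<omega>)"]) blast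
qed

end

theory Submission
  imports Defs
begin

text \<open>
  Polynomials in the values of the path at rational times are dense in \<open>L\<^sup>1(W)\<close>, so the functional
  extends to \<open>L\<^sup>1(W)\<close>. Squares of polynomials approximate indicators, so the extension is positive
  and its values on indicators form a measure \<open>\<gamma> \<le> C W\<close> that represents it. The quadratic variation
  of the path converges to \<open>1\<close> in \<open>L\<^sup>1(W)\<close>, hence, by continuity of the functional, the hypothesis
  with \<open>g = 1\<close> forces \<open>c = 1\<close>. So \<open>\<gamma>\<close> and the
  coordinate process, which is a Brownian motion under \<open>\<eta> = W\<close>, satisfy (i) and (ii), and integration
  against \<open>\<gamma>\<close> extends the functional to polynomials at real times.
\<close>

subsection \<open>Convergence of all moments\<close>

text \<open>Mere L^1 density would not give positivity: the functional is known to be nonnegative on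
  squares, and squaring is not continuous in L^1. All approximation therefore takes place in
  \<open>tends_moments\<close>, convergence in L^k for every k at once, which respects products. If
  F_n tends to the indicator of A in this sense, so does F_n^2, and F_n^2 f tends to f times that
  indicator for every polynomial f; the second fact turns the sign conditions on the f_i into almost
  sure inequalities. Polynomials of the path are unbounded, so bounded functions have to be reached
  first. Gaussian tails do this: exp |u| has all moments when u is a coordinate, hence the Taylor
  series of sin u converges in \<open>tends_moments\<close>. Exponential moments are asked of single
  coordinates only, since these already generate the sigma-algebra. For c = 1, the factor n in front
  of the maximum bounds the sum of the n errors, so the functional of the quadratic variation tends
  to c; by L^1 continuity it also tends to the value at 1.\<close>

lemma Cauchy_Schwarz_integral:
  fixes X Y :: "'a \<Rightarrow> real"
  assumes [measurable]: "X \<in> borel_measurable M" "Y \<in> borel_measurable M"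
    and X: "integrable M (\<lambda>x. (X x)\<^sup>2)" and Y: "integrable M (\<lambda>x. (Y x)\<^sup>2)"
  shows "integrable M (\<lambda>x. X x * Y x)"
    and "(\<integral>x. \<bar>X x * Y x\<bar> \<partial>M) \<le> sqrt (\<integral>x. (X x)\<^sup>2 \<partial>M) * sqrt (\<integral>x. (Y x)\<^sup>2 \<partial>M)"
proof -
  show XY: "integrable M (\<lambda>x. X x * Y x)"
  proof (rule Bochner_Integration.integrable_bound)
    show "integrable M (\<lambda>x. (X x)\<^sup>2 + (Y x)\<^sup>2)"
      using X Y by simp
    show "AE x in M. norm (X x * Y x) \<le> norm ((X x)\<^sup>2 + (Y x)\<^sup>2)"
    proof (rule AE_I2)
      fix x
      have "0 \<le> (\<bar>X x\<bar> - \<bar>Y x\<bar>)\<^sup>2 + (X x)\<^sup>2 + (Y x)\<^sup>2" by simp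
      then have "2 * \<bar>X x * Y x\<bar> \<le> 2 * ((X x)\<^sup>2 + (Y x)\<^sup>2)"
        by (simp add: power2_diff abs_mult)
      then show "norm (X x * Y x) \<le> norm ((X x)\<^sup>2 + (Y x)\<^sup>2)" by simp
    qed
  qed simp
  have "(\<integral>\<^sup>+x. ennreal \<bar>X x\<bar> * ennreal \<bar>Y x\<bar> \<partial>M)\<^sup>2
      \<le> (\<integral>\<^sup>+x. (ennreal \<bar>X x\<bar>)\<^sup>2 \<partial>M) * (\<integral>\<^sup>+x. (ennreal \<bar>Y x\<bar>)\<^sup>2 \<partial>M)"
    by (rule Cauchy_Schwarz_nn_integral) simp_all
  moreover have "(\<integral>\<^sup>+x. ennreal \<bar>X x\<bar> * ennreal \<bar>Y x\<bar> \<partial>M) = ennreal (\<integral>x. \<bar>X x * Y x\<bar> \<partial>M)"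
    using XY by (simp add: ennreal_mult[symmetric] abs_mult[symmetric] nn_integral_eq_integral)
  moreover have "(\<integral>\<^sup>+x. (ennreal \<bar>X x\<bar>)\<^sup>2 \<partial>M) = ennreal (\<integral>x. (X x)\<^sup>2 \<partial>M)"
    using X by (simp add: ennreal_power nn_integral_eq_integral)
  moreover have "(\<integral>\<^sup>+x. (ennreal \<bar>Y x\<bar>)\<^sup>2 \<partial>M) = ennreal (\<integral>x. (Y x)\<^sup>2 \<partial>M)"
    using Y by (simp add: ennreal_power nn_integral_eq_integral)
  ultimately have "ennreal ((\<integral>x. \<bar>X x * Y x\<bar> \<partial>M)\<^sup>2)
      \<le> ennreal ((\<integral>x. (X x)\<^sup>2 \<partial>M) * (\<integral>x. (Y x)\<^sup>2 \<partial>M))"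
    by (simp add: ennreal_power ennreal_mult)
  then have "(\<integral>x. \<bar>X x * Y x\<bar> \<partial>M)\<^sup>2 \<le> (\<integral>x. (X x)\<^sup>2 \<partial>M) * (\<integral>x. (Y x)\<^sup>2 \<partial>M)"
    by (subst (asm) ennreal_le_iff) auto
  then have "sqrt ((\<integral>x. \<bar>X x * Y x\<bar> \<partial>M)\<^sup>2) \<le> sqrt ((\<integral>x. (X x)\<^sup>2 \<partial>M) * (\<integral>x. (Y x)\<^sup>2 \<partial>M))"
    by (rule real_sqrt_le_mono)
  then show "(\<integral>x. \<bar>X x * Y x\<bar> \<partial>M) \<le> sqrt (\<integral>x. (X x)\<^sup>2 \<partial>M) * sqrt (\<integral>x. (Y x)\<^sup>2 \<partial>M)"
    by (simp add: real_sqrt_mult)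
qed

text \<open>From |a + b| \<le> 2 max(|a|, |b|). The constant is not sharp, but only integrability
  and limits equal to 0 are drawn from it.\<close>

lemma abs_add_power_le: "\<bar>a + b\<bar> ^ k \<le> 2 ^ k * (\<bar>a\<bar> ^ k + \<bar>b\<bar> ^ k)" for a b :: real
proof -
  have "\<bar>a + b\<bar> ^ k \<le> (2 * max \<bar>a\<bar> \<bar>b\<bar>) ^ k"
    by (intro power_mono) auto
  also have "\<dots> = 2 ^ k * max \<bar>a\<bar> \<bar>b\<bar> ^ k"
    by (simp add: power_mult_distrib)
  also have "\<dots> \<le> 2 ^ k * (\<bar>a\<bar> ^ k + \<bar>b\<bar> ^ k)"
    by (auto simp: max_def)
  finally show ?thesis .
qed

text \<open>The intersection of all L^k with k finite, an algebra that contains Gaussian variables.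
  Exponent 0 makes it empty unless \<open>M\<close> is finite; measurability is demanded separately
  because that of the powers of |f| does not imply it.\<close>

definition all_moments :: "'a measure \<Rightarrow> ('a \<Rightarrow> real) set" where
  "all_moments M = {f \<in> borel_measurable M. \<forall>k::nat. integrable M (\<lambda>x. \<bar>f x\<bar> ^ k)}"

lemma all_moments_measurable: "f \<in> all_moments M \<Longrightarrow> f \<in> borel_measurable M"
  and all_moments_integrable_power: "f \<in> all_moments M \<Longrightarrow> integrable M (\<lambda>x. \<bar>f x\<bar> ^ k)"
  by (simp_all add: all_moments_def)

lemma all_moments_integrable: "f \<in> all_moments M \<Longrightarrow> integrable M f"
  using all_moments_integrable_power[of f M 1] all_moments_measurable[of f M]
  by (simp add: integrable_abs_iff)

lemma all_moments_bound:
  assumes "g \<in> all_moments M" and [measurable]: "f \<in> borel_measurable M"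
    and "\<And>x. x \<in> space M \<Longrightarrow> \<bar>f x\<bar> \<le> \<bar>g x\<bar>"
  shows "f \<in> all_moments M"
  unfolding all_moments_def mem_Collect_eq
proof (intro conjI allI)
  fix k
  show "integrable M (\<lambda>x. \<bar>f x\<bar> ^ k)"
    by (rule Bochner_Integration.integrable_bound[OF all_moments_integrable_power[OF assms(1)]])
       (auto intro!: AE_I2 power_mono assms(3) simp: power_abs)
qed fact

lemma all_moments_add:
  assumes "f \<in> all_moments M" "g \<in> all_moments M"
  shows "(\<lambda>x. f x + g x) \<in> all_moments M"
proof -
  have [measurable]: "f \<in> borel_measurable M" "g \<in> borel_measurable M"
    using assms by (simp_all add: all_moments_measurable)
  show ?thesis
    unfolding all_moments_def mem_Collect_eq
  proof (intro conjI allI)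
    fix k
    show "integrable M (\<lambda>x. \<bar>f x + g x\<bar> ^ k)"
    proof (rule Bochner_Integration.integrable_bound)
      show "integrable M (\<lambda>x. 2 ^ k * (\<bar>f x\<bar> ^ k + \<bar>g x\<bar> ^ k))"
        using assms by (simp add: all_moments_integrable_power)
      show "AE x in M. norm (\<bar>f x + g x\<bar> ^ k) \<le> norm (2 ^ k * (\<bar>f x\<bar> ^ k + \<bar>g x\<bar> ^ k))"
        using abs_add_power_le[of "f _" "g _" k] by (intro AE_I2) (simp add: abs_mult)
    qed simp
  qed simp
qed

text \<open>Cauchy-Schwarz for |f|^k and |g|^k trades the k-th moment of the product for 2k-th
  moments of the factors, hence the demand for all moments at once.\<close>

lemma all_moments_mult:
  assumes "f \<in> all_moments M" "g \<in> all_moments M"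
  shows "(\<lambda>x. f x * g x) \<in> all_moments M"
proof -
  have [measurable]: "f \<in> borel_measurable M" "g \<in> borel_measurable M"
    using assms by (simp_all add: all_moments_measurable)
  have "integrable M (\<lambda>x. \<bar>f x * g x\<bar> ^ k)" for k
    unfolding abs_mult power_mult_distrib
    by (rule Cauchy_Schwarz_integral)
       (use assms in \<open>auto simp: power_mult[symmetric] all_moments_integrable_power\<close>)
  then show ?thesis
    by (simp add: all_moments_def)
qed

lemma (in finite_measure) all_moments_const: "(\<lambda>_. a) \<in> all_moments M"
  by (simp add: all_moments_def)

lemma (in finite_measure) all_moments_cmult: "f \<in> all_moments M \<Longrightarrow> (\<lambda>x. a * f x) \<in> all_moments M"
  by (intro all_moments_mult all_moments_const)

lemma (in finite_measure) all_moments_diff: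
  assumes "f \<in> all_moments M" "g \<in> all_moments M"
  shows "(\<lambda>x. f x - g x) \<in> all_moments M"
  using all_moments_add[OF assms(1) all_moments_cmult[OF assms(2), of "-1"]] by simp

text \<open>Exponent 0 is excluded, since it would always yield the total mass of
  \<open>M\<close>.\<close>

definition tends_moments :: "'a measure \<Rightarrow> (nat \<Rightarrow> 'a \<Rightarrow> real) \<Rightarrow> ('a \<Rightarrow> real) \<Rightarrow> bool" where
  "tends_moments M F f \<longleftrightarrow> (\<forall>n. F n \<in> all_moments M) \<and> f \<in> all_moments M \<and>
     (\<forall>k>0. (\<lambda>n. \<integral>x. \<bar>F n x - f x\<bar> ^ k \<partial>M) \<longlonglongrightarrow> 0)"

text \<open>Dominated convergence for each exponent: f inherits the bound g, so |F_n - f|^k \<le>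
  2^k |g|^k, which is integrable because g has all moments.\<close>

lemma tends_moments_dominated:
  assumes g: "g \<in> all_moments M" and F [measurable]: "\<And>n. F n \<in> borel_measurable M"
    and lim: "\<And>x. x \<in> space M \<Longrightarrow> (\<lambda>n. F n x) \<longlonglongrightarrow> f x"
    and bound: "\<And>n x. x \<in> space M \<Longrightarrow> \<bar>F n x\<bar> \<le> g x"
  shows "tends_moments M F f"
proof -
  have f[measurable]: "f \<in> borel_measurable M"
    by (rule borel_measurable_LIMSEQ_real[OF lim F])
  have fb: "\<bar>f x\<bar> \<le> g x" if "x \<in> space M" for x
    by (rule LIMSEQ_le_const2[OF tendsto_rabs[OF lim[OF that]]]) (use bound[OF that] in auto)
  have "(\<lambda>n. \<integral>x. \<bar>F n x - f x\<bar> ^ k \<partial>M) \<longlonglongrightarrow> (\<integral>x. 0 \<partial>M)" if "k > 0" for k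
  proof (rule integral_dominated_convergence)
    show "integrable M (\<lambda>x. 2 ^ k * \<bar>g x\<bar> ^ k)"
      using all_moments_integrable_power[OF g] by simp
    show "AE x in M. (\<lambda>n. \<bar>F n x - f x\<bar> ^ k) \<longlonglongrightarrow> 0"
    proof (rule AE_I2)
      fix x assume "x \<in> space M"
      then have "(\<lambda>n. \<bar>F n x - f x\<bar> ^ k) \<longlonglongrightarrow> \<bar>f x - f x\<bar> ^ k"
        by (intro tendsto_intros lim)
      then show "(\<lambda>n. \<bar>F n x - f x\<bar> ^ k) \<longlonglongrightarrow> 0"
        using that by (simp add: zero_power)
    qed
    fix n
    show "AE x in M. norm (\<bar>F n x - f x\<bar> ^ k) \<le> 2 ^ k * \<bar>g x\<bar> ^ k"
    proof (rule AE_I2)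
      fix x assume x: "x \<in> space M"
      have "\<bar>F n x - f x\<bar> ^ k \<le> (2 * \<bar>g x\<bar>) ^ k"
        using bound[OF x, of n] fb[OF x] by (intro power_mono) linarith+
      then show "norm (\<bar>F n x - f x\<bar> ^ k) \<le> 2 ^ k * \<bar>g x\<bar> ^ k"
        by (simp add: power_mult_distrib)
    qed
  qed simp_all
  moreover have "F n \<in> all_moments M" for n
    by (rule all_moments_bound[OF g]) (use bound[of _ n] in \<open>auto intro: order_trans[OF _ abs_ge_self]\<close>)
  moreover have "f \<in> all_moments M"
    by (rule all_moments_bound[OF g]) (use fb in \<open>auto intro: order_trans[OF _ abs_ge_self]\<close>)
  ultimately show ?thesis
    by (simp add: tends_moments_def)
qed

lemma (in finite_measure) tends_moments_L1:
  assumes "tends_moments M F f"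
  shows "(\<lambda>n. \<integral>x. \<bar>F n x - f x\<bar> \<partial>M) \<longlonglongrightarrow> 0"
  using assms[unfolded tends_moments_def, THEN conjunct2, THEN conjunct2, rule_format, of 1]
  by simp

lemma tendsto_0_integral_sandwich:
  fixes X :: "nat \<Rightarrow> 'a \<Rightarrow> real"
  assumes "\<And>n x. x \<in> space M \<Longrightarrow> 0 \<le> X n x" "\<And>n x. x \<in> space M \<Longrightarrow> X n x \<le> Y n x" "\<And>n. integrable M (Y n)"
    "(\<lambda>n. integral\<^sup>L M (Y n)) \<longlonglongrightarrow> 0"
  shows "(\<lambda>n. integral\<^sup>L M (X n)) \<longlonglongrightarrow> 0"
proof (rule tendsto_sandwich[OF _ _ tendsto_const assms(4)])
  show "\<forall>\<^sub>F n in sequentially. 0 \<le> integral\<^sup>L M (X n)"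
    by (intro always_eventually allI integral_nonneg_AE AE_I2 assms(1))
  show "\<forall>\<^sub>F n in sequentially. integral\<^sup>L M (X n) \<le> integral\<^sup>L M (Y n)"
    by (intro always_eventually allI integral_mono_AE' AE_I2) (auto intro: assms order_trans)
qed

lemma (in finite_measure) tends_moments_add:
  assumes F: "tends_moments M F f" and G: "tends_moments M G g"
  shows "tends_moments M (\<lambda>n x. F n x + G n x) (\<lambda>x. f x + g x)"
proof -
  have m: "F n \<in> all_moments M" "G n \<in> all_moments M" "f \<in> all_moments M" "g \<in> all_moments M" for n
    using F G by (auto simp: tends_moments_def)
  note i = all_moments_integrable_power[OF all_moments_diff]
  have "(\<lambda>n. \<integral>x. \<bar>(F n x + G n x) - (f x + g x)\<bar> ^ k \<partial>M) \<longlonglongrightarrow> 0" if "k > 0" for k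
  proof (rule tendsto_0_integral_sandwich)
    show "\<bar>(F n x + G n x) - (f x + g x)\<bar> ^ k \<le> 2 ^ k * (\<bar>F n x - f x\<bar> ^ k + \<bar>G n x - g x\<bar> ^ k)" for n x
      using abs_add_power_le[of "F n x - f x" "G n x - g x" k] by (simp add: algebra_simps)
    show "integrable M (\<lambda>x. 2 ^ k * (\<bar>F n x - f x\<bar> ^ k + \<bar>G n x - g x\<bar> ^ k))" for n
      by (intro integrable_mult_right Bochner_Integration.integrable_add i m)
    have "(\<lambda>n. 2 ^ k * ((\<integral>x. \<bar>F n x - f x\<bar> ^ k \<partial>M) + (\<integral>x. \<bar>G n x - g x\<bar> ^ k \<partial>M))) \<longlonglongrightarrow> 2 ^ k * (0 + 0)"
      using F G that by (intro tendsto_intros) (auto simp: tends_moments_def)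
    then show "(\<lambda>n. \<integral>x. 2 ^ k * (\<bar>F n x - f x\<bar> ^ k + \<bar>G n x - g x\<bar> ^ k) \<partial>M) \<longlonglongrightarrow> 0"
      by (simp add: i m Bochner_Integration.integral_add)
  qed simp
  then show ?thesis
    using m by (simp add: tends_moments_def all_moments_add)
qed

text \<open>Cauchy-Schwarz bounds the k-th moment of the product by 2k-th moments of F_n, which
  vanish, and of the other factor, which need only converge. Writing G_n = (G_n - g) + g makes that
  convergence trivial: the moments of the first summand tend to 0, those of the second are
  constant.\<close>

lemma (in finite_measure) tends_moments_mult_null:
  assumes F: "tends_moments M F (\<lambda>_. 0)" and G: "tends_moments M G g"
  shows "tends_moments M (\<lambda>n x. F n x * G n x) (\<lambda>_. 0)"
proof -
  have m: "F n \<in> all_moments M" "G n \<in> all_moments M" "g \<in> all_moments M" for n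
    using F G by (auto simp: tends_moments_def)
  have [measurable]: "F n \<in> borel_measurable M" "G n \<in> borel_measurable M" "g \<in> borel_measurable M" for n
    by (intro all_moments_measurable m)+
  note i = all_moments_integrable_power
  have aux: "(\<lambda>n. \<integral>x. \<bar>F n x * H n x\<bar> ^ k \<partial>M) \<longlonglongrightarrow> 0"
    if "k > 0" and H: "\<And>n. H n \<in> all_moments M"
      "(\<lambda>n. \<integral>x. (\<bar>H n x\<bar> ^ k)\<^sup>2 \<partial>M) \<longlonglongrightarrow> l" for H k l
  proof (rule tendsto_sandwich[OF _ _ tendsto_const])
    show "\<forall>\<^sub>F n in sequentially. 0 \<le> (\<integral>x. \<bar>F n x * H n x\<bar> ^ k \<partial>M)"
      by simp
    have "(\<integral>x. \<bar>F n x * H n x\<bar> ^ k \<partial>M) \<le>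
        sqrt (\<integral>x. (\<bar>F n x\<bar> ^ k)\<^sup>2 \<partial>M) * sqrt (\<integral>x. (\<bar>H n x\<bar> ^ k)\<^sup>2 \<partial>M)" for n
      using Cauchy_Schwarz_integral(2)[of "\<lambda>x. \<bar>F n x\<bar> ^ k" M "\<lambda>x. \<bar>H n x\<bar> ^ k"]
        all_moments_measurable[OF H(1)] i[OF m(1)] i[OF H(1)]
      by (simp add: power_mult[symmetric] abs_mult power_mult_distrib)
    then show "\<forall>\<^sub>F n in sequentially. (\<integral>x. \<bar>F n x * H n x\<bar> ^ k \<partial>M) \<le>
        sqrt (\<integral>x. (\<bar>F n x\<bar> ^ k)\<^sup>2 \<partial>M) * sqrt (\<integral>x. (\<bar>H n x\<bar> ^ k)\<^sup>2 \<partial>M)"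
      by simp
    have "(\<lambda>n. \<integral>x. (\<bar>F n x\<bar> ^ k)\<^sup>2 \<partial>M) \<longlonglongrightarrow> 0"
      using F \<open>k > 0\<close> by (simp add: tends_moments_def power_mult[symmetric])
    then have "(\<lambda>n. sqrt (\<integral>x. (\<bar>F n x\<bar> ^ k)\<^sup>2 \<partial>M) * sqrt (\<integral>x. (\<bar>H n x\<bar> ^ k)\<^sup>2 \<partial>M)) \<longlonglongrightarrow> sqrt 0 * sqrt l"
      by (intro tendsto_intros H)
    then show "(\<lambda>n. sqrt (\<integral>x. (\<bar>F n x\<bar> ^ k)\<^sup>2 \<partial>M) * sqrt (\<integral>x. (\<bar>H n x\<bar> ^ k)\<^sup>2 \<partial>M)) \<longlonglongrightarrow> 0"
      by simp
  qed
  have 1: "tends_moments M (\<lambda>n x. F n x * (G n x - g x)) (\<lambda>_. 0)"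
  proof -
    have "(\<lambda>n. \<integral>x. (\<bar>G n x - g x\<bar> ^ k)\<^sup>2 \<partial>M) \<longlonglongrightarrow> 0" if "k > 0" for k
      using G that by (simp add: tends_moments_def power_mult[symmetric])
    from aux[OF _ _ this] show ?thesis
      by (simp add: tends_moments_def m all_moments_mult all_moments_diff all_moments_const)
  qed
  have 2: "tends_moments M (\<lambda>n x. F n x * g x) (\<lambda>_. 0)"
    using aux[of _ "\<lambda>_. g", OF _ _ tendsto_const]
    by (simp add: tends_moments_def m all_moments_mult all_moments_const)
  show ?thesis
    using tends_moments_add[OF 1 2] by (simp add: algebra_simps)
qed

lemma (in finite_measure) tends_moments_const:
  "f \<in> all_moments M \<Longrightarrow> tends_moments M (\<lambda>_. f) f"
  by (simp add: tends_moments_def zero_power)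

lemma (in finite_measure) tends_moments_null:
  "tends_moments M F f \<Longrightarrow> tends_moments M (\<lambda>n x. F n x - f x) (\<lambda>_. 0)"
  by (simp add: tends_moments_def all_moments_diff all_moments_const)

text \<open>F_n G_n - f g = (F_n - f) G_n + (G_n - g) f, and each summand has a null factor.\<close>

lemma (in finite_measure) tends_moments_mult:
  assumes F: "tends_moments M F f" and G: "tends_moments M G g"
  shows "tends_moments M (\<lambda>n x. F n x * G n x) (\<lambda>x. f x * g x)"
proof -
  have m: "f \<in> all_moments M" "g \<in> all_moments M"
    using F G by (auto simp: tends_moments_def)
  have 1: "tends_moments M (\<lambda>n x. (F n x - f x) * G n x) (\<lambda>_. 0)"
    by (rule tends_moments_mult_null[OF tends_moments_null[OF F] G])
  have 2: "tends_moments M (\<lambda>n x. (G n x - g x) * f x) (\<lambda>_. 0)"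
    by (rule tends_moments_mult_null[OF tends_moments_null[OF G] tends_moments_const[OF m(1)]])
  have 3: "tends_moments M (\<lambda>n x. f x * g x) (\<lambda>x. f x * g x)"
    by (intro tends_moments_const all_moments_mult m)
  show ?thesis
    using tends_moments_add[OF tends_moments_add[OF 1 2] 3] by (simp add: algebra_simps)
qed

lemma (in finite_measure) tends_moments_transfer:
  assumes "tends_moments M F f" "tends_moments M (\<lambda>n x. G n x - F n x) (\<lambda>_. 0)"
  shows "tends_moments M G f"
  using tends_moments_add[OF assms] by simp

subsection \<open>Density of algebras of exponentially integrable functions\<close>

locale moment_algebra = finite_measure M for M :: "'a measure" +
  fixes P :: "('a \<Rightarrow> real) set"
  assumes P_const: "(\<lambda>_. a) \<in> P"
    and P_add: "p \<in> P \<Longrightarrow> q \<in> P \<Longrightarrow> (\<lambda>x. p x + q x) \<in> P"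
    and P_mult: "p \<in> P \<Longrightarrow> q \<in> P \<Longrightarrow> (\<lambda>x. p x * q x) \<in> P"
    and P_moments: "P \<subseteq> all_moments M"
begin

definition moment_closure :: "('a \<Rightarrow> real) set" where
  "moment_closure = {f. \<exists>F. range F \<subseteq> P \<and> tends_moments M F f}"

lemma P_cmult: "p \<in> P \<Longrightarrow> (\<lambda>x. a * p x) \<in> P"
  by (intro P_mult P_const)

lemma P_power: "p \<in> P \<Longrightarrow> (\<lambda>x. p x ^ n) \<in> P"
  by (induction n) (auto intro: P_const P_mult)

lemma P_sum: "(\<And>i. i \<in> I \<Longrightarrow> p i \<in> P) \<Longrightarrow> (\<lambda>x. \<Sum>i\<in>I. p i x) \<in> P"
  by (induction I rule: infinite_finite_induct) (auto intro: P_const P_add)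

lemma moment_closure_all_moments: "f \<in> moment_closure \<Longrightarrow> f \<in> all_moments M"
  by (auto simp: moment_closure_def tends_moments_def)

lemma P_subset_moment_closure: "p \<in> P \<Longrightarrow> p \<in> moment_closure"
  using tends_moments_const[of p] P_moments
  by (auto simp: moment_closure_def intro!: exI[of _ "\<lambda>_. p"])

lemma moment_closure_add: "f \<in> moment_closure \<Longrightarrow> g \<in> moment_closure \<Longrightarrow> (\<lambda>x. f x + g x) \<in> moment_closure"
  unfolding moment_closure_def
proof safe
  fix F G assume "range F \<subseteq> P" "range G \<subseteq> P" "tends_moments M F f" "tends_moments M G g"
  then show "\<exists>H. range H \<subseteq> P \<and> tends_moments M H (\<lambda>x. f x + g x)"
    by (intro exI[of _ "\<lambda>n x. F n x + G n x"] conjI tends_moments_add) (auto intro: P_add)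
qed

lemma moment_closure_mult: "f \<in> moment_closure \<Longrightarrow> g \<in> moment_closure \<Longrightarrow> (\<lambda>x. f x * g x) \<in> moment_closure"
  unfolding moment_closure_def
proof safe
  fix F G assume "range F \<subseteq> P" "range G \<subseteq> P" "tends_moments M F f" "tends_moments M G g"
  then show "\<exists>H. range H \<subseteq> P \<and> tends_moments M H (\<lambda>x. f x * g x)"
    by (intro exI[of _ "\<lambda>n x. F n x * G n x"] conjI tends_moments_mult) (auto intro: P_mult)
qed

lemma moment_closure_const: "(\<lambda>_. a) \<in> moment_closure"
  by (intro P_subset_moment_closure P_const)

lemma moment_closure_approx:
  assumes "f \<in> moment_closure" "e > 0"
  shows "\<exists>p\<in>P. \<forall>k\<in>{1..m}. (\<integral>x. \<bar>p x - f x\<bar> ^ k \<partial>M) < e"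
proof -
  obtain F where F: "range F \<subseteq> P" "tends_moments M F f"
    using assms by (auto simp: moment_closure_def)
  have "\<forall>\<^sub>F n in sequentially. \<forall>k\<in>{1..m}. (\<integral>x. \<bar>F n x - f x\<bar> ^ k \<partial>M) < e"
  proof (rule eventually_ball_finite)
    show "\<forall>k\<in>{1..m}. \<forall>\<^sub>F n in sequentially. (\<integral>x. \<bar>F n x - f x\<bar> ^ k \<partial>M) < e"
    proof
      fix k assume "k \<in> {1..m}"
      then have "(\<lambda>n. \<integral>x. \<bar>F n x - f x\<bar> ^ k \<partial>M) \<longlonglongrightarrow> 0"
        using F(2) by (simp add: tends_moments_def)
      then show "\<forall>\<^sub>F n in sequentially. (\<integral>x. \<bar>F n x - f x\<bar> ^ k \<partial>M) < e"
        using assms(2) by (rule order_tendstoD)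
    qed
  qed simp
  then obtain n where "\<forall>k\<in>{1..m}. (\<integral>x. \<bar>F n x - f x\<bar> ^ k \<partial>M) < e"
    by (auto simp: eventually_sequentially)
  then show ?thesis
    using F(1) by blast
qed

text \<open>A diagonal choice: p_n is within 1/(n+1) of F_n for the exponents 1 to n. For a fixed
  exponent k this controls all n \<ge> k, so p_n - F_n is null in every moment.\<close>

lemma moment_closure_limit:
  assumes F: "\<And>n. F n \<in> moment_closure" and f: "tends_moments M F f"
  shows "f \<in> moment_closure"
proof -
  have "\<exists>p. p \<in> P \<and> (\<forall>k\<in>{1..n}. (\<integral>x. \<bar>p x - F n x\<bar> ^ k \<partial>M) < inverse (real (Suc n)))" for n
    using moment_closure_approx[OF F, of "inverse (real (Suc n))" n] by auto
  then obtain p where p: "\<And>n. p n \<in> P"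
    "\<And>n k. k \<in> {1..n} \<Longrightarrow> (\<integral>x. \<bar>p n x - F n x\<bar> ^ k \<partial>M) < inverse (real (Suc n))"
    by metis
  have "(\<lambda>n. \<integral>x. \<bar>p n x - F n x\<bar> ^ k \<partial>M) \<longlonglongrightarrow> 0" if "k > 0" for k
  proof (rule tendsto_sandwich[OF _ _ tendsto_const LIMSEQ_inverse_real_of_nat])
    show "\<forall>\<^sub>F n in sequentially. (\<integral>x. \<bar>p n x - F n x\<bar> ^ k \<partial>M) \<le> inverse (real (Suc n))"
      unfolding eventually_sequentially
      by (rule exI[of _ k]) (use p(2)[of k] that in \<open>auto intro: less_imp_le\<close>)
  qed simp
  moreover have "p n \<in> all_moments M" "F n \<in> all_moments M" for n
    using P_moments p(1) moment_closure_all_moments[OF F] by auto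
  ultimately have "tends_moments M (\<lambda>n x. p n x - F n x) (\<lambda>_. 0)"
    by (simp add: tends_moments_def all_moments_const all_moments_diff)
  then have "tends_moments M p f"
    by (rule tends_moments_transfer[OF f])
  with p(1) show ?thesis
    by (auto simp: moment_closure_def)
qed

lemma moment_closure_dominated_limit:
  assumes g: "g \<in> all_moments M" and F: "\<And>n. F n \<in> moment_closure"
    and lim: "\<And>x. x \<in> space M \<Longrightarrow> (\<lambda>n. F n x) \<longlonglongrightarrow> f x"
    and bound: "\<And>n x. x \<in> space M \<Longrightarrow> \<bar>F n x\<bar> \<le> g x"
  shows "f \<in> moment_closure"
  by (rule moment_closure_limit[OF F tends_moments_dominated[OF g _ lim bound]])
     (auto intro: all_moments_measurable moment_closure_all_moments F)

lemma moment_closure_compose_polynomial: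
  fixes g :: "real \<Rightarrow> real"
  assumes "real_polynomial_function g" "u \<in> moment_closure"
  shows "(\<lambda>x. g (u x)) \<in> moment_closure"
  using assms(1)
proof induction
  case (linear h)
  interpret bounded_linear h by fact
  have "h (u x) = h 1 * u x" for x
    using scaleR[of "u x" 1] by simp
  then show ?case
    using moment_closure_mult[OF moment_closure_const assms(2), of "h 1"] by simp
qed (auto intro: moment_closure_const moment_closure_add moment_closure_mult)

text \<open>Weierstrass approximation on [-B, B], where u has its values; the uniform error also
  provides a constant dominating function.\<close>

lemma moment_closure_compose_continuous_bounded:
  fixes \<psi> :: "real \<Rightarrow> real"
  assumes u: "u \<in> moment_closure" and bound: "\<And>x. x \<in> space M \<Longrightarrow> \<bar>u x\<bar> \<le> B"
    and \<psi>: "continuous_on {-B..B} \<psi>"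
  shows "(\<lambda>x. \<psi> (u x)) \<in> moment_closure"
proof -
  have "\<exists>g. real_polynomial_function g \<and> (\<forall>y\<in>{-B..B}. \<bar>\<psi> y - g y\<bar> < inverse (real (Suc n)))" for n
    using Stone_Weierstrass_real_polynomial_function[OF compact_Icc \<psi>, of "inverse (real (Suc n))"]
    by (metis inverse_positive_iff_positive of_nat_0_less_iff zero_less_Suc)
  then obtain g where g: "\<And>n. real_polynomial_function (g n)"
    "\<And>n y. y \<in> {-B..B} \<Longrightarrow> \<bar>\<psi> y - g n y\<bar> < inverse (real (Suc n))"
    by metis
  have uB: "u x \<in> {-B..B}" if "x \<in> space M" for x
    using bound[OF that] by auto
  have "bounded (\<psi> ` {-B..B})"
    by (intro compact_imp_bounded compact_continuous_image \<psi>) simp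
  then obtain C where C: "\<And>y. y \<in> {-B..B} \<Longrightarrow> \<bar>\<psi> y\<bar> \<le> C"
    by (force simp: bounded_iff)
  show ?thesis
  proof (rule moment_closure_dominated_limit)
    show "(\<lambda>x. g n (u x)) \<in> moment_closure" for n
      by (rule moment_closure_compose_polynomial[OF g(1) u])
    show "(\<lambda>_. C + 1) \<in> all_moments M"
      by (rule all_moments_const)
    show "\<bar>g n (u x)\<bar> \<le> C + 1" if "x \<in> space M" for n x
    proof -
      have "inverse (real (Suc n)) \<le> 1"
        by (simp add: field_simps)
      then show ?thesis
        using g(2)[OF uB[OF that], of n] C[OF uB[OF that]] by linarith
    qed
    show "(\<lambda>n. g n (u x)) \<longlonglongrightarrow> \<psi> (u x)" if "x \<in> space M" for x
    proof (rule LIM_zero_cancel, rule Lim_null_comparison[OF _ LIMSEQ_inverse_real_of_nat])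
      show "\<forall>\<^sub>F n in sequentially. norm (g n (u x) - \<psi> (u x)) \<le> inverse (real (Suc n))"
        using g(2)[OF uB[OF that]] by (auto intro!: always_eventually less_imp_le simp: abs_minus_commute)
    qed
  qed
qed

text \<open>The partial sums of the sine series are dominated termwise by the series of exp |u|.
  Exponential integrability enters here: it makes this common bound a function with all
  moments.\<close>

lemma moment_closure_sin:
  assumes u: "u \<in> P" and E: "(\<lambda>x. exp \<bar>u x\<bar>) \<in> all_moments M"
  shows "(\<lambda>x. sin (u x)) \<in> moment_closure"
proof (rule moment_closure_dominated_limit[OF E])
  show "(\<lambda>x. \<Sum>i<n. sin_coeff i * u x ^ i) \<in> moment_closure" for n
    by (intro P_subset_moment_closure P_sum P_cmult P_power u)
  show "(\<lambda>n. \<Sum>i<n. sin_coeff i * u x ^ i) \<longlonglongrightarrow> sin (u x)" for x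
    using sin_converges[of "u x"] by (simp add: sums_def)
  show "\<bar>\<Sum>i<n. sin_coeff i * u x ^ i\<bar> \<le> exp \<bar>u x\<bar>" for n x
  proof -
    have "\<bar>\<Sum>i<n. sin_coeff i * u x ^ i\<bar> \<le> (\<Sum>i<n. inverse (fact i) * \<bar>u x\<bar> ^ i)"
    proof (rule order_trans[OF sum_abs sum_mono])
      fix i
      have "\<bar>sin_coeff i\<bar> \<le> (inverse (fact i) :: real)"
        by (auto simp: sin_coeff_def power_abs divide_inverse abs_mult)
      then show "\<bar>sin_coeff i * u x ^ i\<bar> \<le> inverse (fact i) * \<bar>u x\<bar> ^ i"
        unfolding abs_mult power_abs by (rule mult_right_mono) simp
    qed
    also have "\<dots> \<le> suminf (\<lambda>i. inverse (fact i) * \<bar>u x\<bar> ^ i)"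
      by (rule sum_le_suminf[OF summable_exp]) auto
    also have "\<dots> = exp \<bar>u x\<bar>"
      by (simp add: exp_def divide_inverse mult.commute)
    finally show ?thesis .
  qed
qed

text \<open>The difference quotient of h -> sin (h y) at 0, taken along h = 1/(n+1).\<close>

lemma scaled_sin_tendsto: "(\<lambda>n. real (Suc n) * sin (inverse (real (Suc n)) * y)) \<longlonglongrightarrow> y"
proof -
  have "((\<lambda>h. sin (h * y)) has_real_derivative cos (0 * y) * (1 * y)) (at 0)"
    by (rule derivative_eq_intros refl | simp)+
  then have "((\<lambda>h. sin (h * y) / h) \<longlongrightarrow> y) (at 0)"
    by (simp add: DERIV_def)
  moreover have "filterlim (\<lambda>n. inverse (real (Suc n))) (at 0) sequentially"
    by (rule filterlim_atI[OF LIMSEQ_inverse_real_of_nat]) simp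
  ultimately have "(\<lambda>n. sin (inverse (real (Suc n)) * y) / inverse (real (Suc n))) \<longlonglongrightarrow> y"
    by (rule filterlim_compose)
  then show ?thesis
    by (simp add: divide_inverse mult.commute)
qed

text \<open>Polynomials are unbounded, so Weierstrass approximation does not apply to them directly; the
  bounded functions \<open>n sin (u / n)\<close>, which converge to \<open>u\<close>, serve as a substitute.\<close>

lemma moment_closure_compose_bounded_continuous:
  fixes \<psi> :: "real \<Rightarrow> real"
  assumes u: "u \<in> P" and E: "(\<lambda>x. exp \<bar>u x\<bar>) \<in> all_moments M"
    and \<psi>: "continuous_on UNIV \<psi>" and bound: "\<And>y. \<bar>\<psi> y\<bar> \<le> C"
  shows "(\<lambda>x. \<psi> (u x)) \<in> moment_closure"
proof (rule moment_closure_dominated_limit)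
  have [measurable]: "u \<in> borel_measurable M"
    using u P_moments all_moments_measurable by blast
  show "(\<lambda>_. C) \<in> all_moments M"
    by (rule all_moments_const)
  show "(\<lambda>x. \<psi> (real (Suc n) * sin (inverse (real (Suc n)) * u x))) \<in> moment_closure" for n
  \<comment> \<open>The factor n+1 is moved into \<open>\<psi>\<close>, so that the inner function
    sin (u / (n+1)) has values in [-1, 1] for every n.\<close>
  proof (rule moment_closure_compose_continuous_bounded[where \<psi> = "\<lambda>y. \<psi> (real (Suc n) * y)" and B = 1])
    show "(\<lambda>x. sin (inverse (real (Suc n)) * u x)) \<in> moment_closure"
    proof (rule moment_closure_sin)
      show "(\<lambda>x. exp \<bar>inverse (real (Suc n)) * u x\<bar>) \<in> all_moments M"
      proof (rule all_moments_bound[OF E])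
        fix x
        have "\<bar>inverse (real (Suc n)) * u x\<bar> \<le> 1 * \<bar>u x\<bar>"
          unfolding abs_mult by (rule mult_right_mono) (auto simp: field_simps)
        then show "\<bar>exp \<bar>inverse (real (Suc n)) * u x\<bar>\<bar> \<le> \<bar>exp \<bar>u x\<bar>\<bar>"
          by simp
      qed measurable
    qed (intro P_cmult u)
    show "continuous_on {-1..1} (\<lambda>y. \<psi> (real (Suc n) * y))"
      by (intro continuous_on_compose2[OF \<psi>] continuous_intros) auto
  qed simp
  show "(\<lambda>n. \<psi> (real (Suc n) * sin (inverse (real (Suc n)) * u x))) \<longlonglongrightarrow> \<psi> (u x)" for x
    by (rule continuous_on_tendsto_compose[OF \<psi> scaled_sin_tendsto]) auto
qed (rule bound)

text \<open>The ramps min 1 (n max 0 (u - a)) converge pointwise to the indicator; they vanish where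
  u = a, which is why the superlevel set is strict.\<close>

lemma moment_closure_indicator_greater:
  assumes u: "u \<in> P" and E: "(\<lambda>x. exp \<bar>u x\<bar>) \<in> all_moments M"
  shows "indicator {x \<in> space M. a < u x} \<in> moment_closure"
proof (rule moment_closure_dominated_limit)
  show "(\<lambda>_. 1) \<in> all_moments M"
    by (rule all_moments_const)
  show "(\<lambda>x. min 1 (real n * max 0 (u x - a))) \<in> moment_closure" for n
    by (rule moment_closure_compose_bounded_continuous[OF u E, of "\<lambda>y. min 1 (real n * max 0 (y - a))" 1])
       (auto intro!: continuous_intros)
  show "(\<lambda>n. min 1 (real n * max 0 (u x - a))) \<longlonglongrightarrow> indicator {x \<in> space M. a < u x} x"
    if x: "x \<in> space M" for x
  proof (cases "a < u x")
    case True
    obtain N where "1 \<le> real N * (u x - a)"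
      using ex_less_of_nat_mult[of "u x - a" 1] True by (auto intro: less_imp_le)
    then have "1 \<le> real n * (u x - a)" if "n \<ge> N" for n
      using mult_right_mono[of "real N" "real n" "u x - a"] that True by linarith
    then have "\<forall>\<^sub>F n in sequentially. min 1 (real n * max 0 (u x - a)) = 1"
      unfolding eventually_sequentially using True by (intro exI[of _ N]) (auto simp: max_def min_def)
    then show ?thesis
      using True x by (simp add: tendsto_eventually)
  qed (auto simp: max_def)
qed auto

section \<open>The sigma-algebra of sets with approximable indicator\<close>

definition moment_closure_sets :: "'a measure" where
  "moment_closure_sets = sigma (space M) {A \<in> sets M. indicator A \<in> moment_closure}"

lemma moment_closure_compl: "A \<in> sets M \<Longrightarrow> indicator A \<in> moment_closure \<Longrightarrow> indicator (space M - A) \<in> moment_closure"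
proof -
  assume A: "A \<in> sets M" "indicator A \<in> moment_closure"
  have "(\<lambda>x. 1 + (-1) * indicator A x :: real) \<in> moment_closure"
    by (intro moment_closure_add moment_closure_mult moment_closure_const A)
  then show "indicator (space M - A) \<in> moment_closure"
    \<comment> \<open>The two functions agree on \<open>space M\<close> only. Since limits are
      tested there alone, a constant sequence turns this agreement into membership.\<close>
    by (rule moment_closure_dominated_limit[OF all_moments_const[of 1], of "\<lambda>_. \<lambda>x. 1 + (-1) * indicator A x"])
       (use A in \<open>auto simp: indicator_def\<close>)
qed

text \<open>Inclusion-exclusion for two sets: the indicator of a union is the sum of the indicators
  minus their product, and products stay in the closure.\<close>

lemma moment_closure_finite_UN:
  assumes "\<And>i. indicator (A i :: 'a set) \<in> moment_closure"
  shows "indicator (\<Union>i<n::nat. A i) \<in> moment_closure"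
proof (induction n)
  case 0
  show ?case using moment_closure_const[of 0] by (simp add: indicator_def[abs_def])
next
  case (Suc n)
  let ?U = "\<Union>i<n. A i"
  have "(\<lambda>x. indicator ?U x + (indicator (A n) x + (-1) * (indicator ?U x * indicator (A n) x)) :: real) \<in> moment_closure"
    by (intro moment_closure_add moment_closure_mult moment_closure_const Suc assms)
  also have "(\<lambda>x. indicator ?U x + (indicator (A n) x + (-1) * (indicator ?U x * indicator (A n) x)) :: real)
     = indicator (\<Union>i<Suc n. A i)"
    by (auto simp: indicator_def fun_eq_iff less_Suc_eq split: if_splits)
  finally show ?case .
qed

text \<open>The class is a sigma-algebra already, so \<open>sigma\<close> adds no sets: products
  give finite unions, and limits dominated by 1 give countable ones. This takes the place of a
  monotone class argument.\<close>

lemma sets_moment_closure_sets: "sets moment_closure_sets = {A \<in> sets M. indicator A \<in> moment_closure}"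
proof -
  have "sigma_algebra (space M) {A \<in> sets M. indicator A \<in> moment_closure}"
    unfolding sigma_algebra_iff2
  proof (intro conjI ballI allI impI)
    show "{} \<in> {A \<in> sets M. indicator A \<in> moment_closure}"
      using moment_closure_const[of 0] by (simp add: indicator_def[abs_def])
  next
    fix A :: "nat \<Rightarrow> 'a set" assume A: "range A \<subseteq> {A \<in> sets M. indicator A \<in> moment_closure}"
    have "indicator (\<Union>i. A i) \<in> moment_closure"
    proof (rule moment_closure_dominated_limit)
      show "indicator (\<Union>i<n. A i) \<in> moment_closure" for n
        by (rule moment_closure_finite_UN) (use A in auto)
      show "(\<lambda>n. indicator (\<Union>i<n. A i) x) \<longlonglongrightarrow> (indicator (\<Union>i. A i) x :: real)" for x
        by (rule LIMSEQ_indicator_UN)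
      show "(\<lambda>_. 1) \<in> all_moments M"
        by (rule all_moments_const)
    qed auto
    with A show "(\<Union>i. A i) \<in> {A \<in> sets M. indicator A \<in> moment_closure}" by auto
  qed (auto simp: moment_closure_compl dest: sets.sets_into_space)
  then show ?thesis
    unfolding moment_closure_sets_def by (rule sigma_algebra.sets_measure_of_eq)
qed

lemma space_moment_closure_sets [simp]: "space moment_closure_sets = space M"
  unfolding moment_closure_sets_def by (rule space_measure_of) (auto dest: sets.sets_into_space)

text \<open>Preimages of open half-lines suffice. Applied to coordinates, this puts the generators
  of the path sigma-algebra into the class of approximable sets.\<close>

lemma measurable_moment_closure_sets:
  assumes "u \<in> P" "(\<lambda>x. exp \<bar>u x\<bar>) \<in> all_moments M"
  shows "u \<in> borel_measurable moment_closure_sets"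
proof (rule borel_measurableI_greater)
  fix a
  have [measurable]: "u \<in> borel_measurable M"
    using assms P_moments all_moments_measurable by blast
  show "{x \<in> space moment_closure_sets. a < u x} \<in> sets moment_closure_sets"
    unfolding sets_moment_closure_sets using moment_closure_indicator_greater[OF assms] by simp
qed

end

locale dense_moment_algebra = moment_algebra +
  assumes dense: "\<And>A. A \<in> sets M \<Longrightarrow> indicator A \<in> moment_closure"
begin

text \<open>Induction over integrable functions: indicators come from \<open>dense\<close>, sums are
  met with half the error each, and in the limit case |s_i| \<le> 2 |f| gives the dominating
  function 3 |f|.\<close>

lemma L1_approx:
  assumes "integrable M f" "0 < e"
  shows "\<exists>p\<in>P. (\<integral>x. \<bar>p x - f x\<bar> \<partial>M) < e"
  using assms
proof (induction f arbitrary: e rule: integrable_induct)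
  case (base A c)
  have "(\<lambda>x. indicator A x * c) \<in> moment_closure"
    by (intro moment_closure_mult moment_closure_const dense base)
  from moment_closure_approx[OF this base(3), of 1] show ?case
    by auto
next
  case (add f g)
  from add.IH(1)[of "e/2"] add.IH(2)[of "e/2"] add.prems obtain p q where
    p: "p \<in> P" "(\<integral>x. \<bar>p x - f x\<bar> \<partial>M) < e/2" and q: "q \<in> P" "(\<integral>x. \<bar>q x - g x\<bar> \<partial>M) < e/2"
    by auto
  have pq: "integrable M p" "integrable M q"
    using p q P_moments all_moments_integrable by blast+
  have "(\<integral>x. \<bar>(p x + q x) - (f x + g x)\<bar> \<partial>M) \<le> (\<integral>x. \<bar>p x - f x\<bar> + \<bar>q x - g x\<bar> \<partial>M)"
    by (rule integral_mono) (use pq add.hyps in auto)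
  also have "\<dots> = (\<integral>x. \<bar>p x - f x\<bar> \<partial>M) + (\<integral>x. \<bar>q x - g x\<bar> \<partial>M)"
    by (rule Bochner_Integration.integral_add) (use pq add.hyps in auto)
  finally show ?case
    using p q by (intro bexI[of _ "\<lambda>x. p x + q x"] P_add) auto
next
  case (lim f s)
  have "(\<lambda>i. \<integral>x. \<bar>s i x - f x\<bar> \<partial>M) \<longlonglongrightarrow> (\<integral>x. 0 \<partial>M)"
  proof (rule integral_dominated_convergence)
    show "integrable M (\<lambda>x. 3 * \<bar>f x\<bar>)"
      using lim by auto
    show "AE x in M. (\<lambda>i. \<bar>s i x - f x\<bar>) \<longlonglongrightarrow> 0"
      using lim.hyps(2) by (intro AE_I2 tendsto_rabs_zero LIM_zero)
    show "AE x in M. norm \<bar>s i x - f x\<bar> \<le> 3 * \<bar>f x\<bar>" for i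
    proof (rule AE_I2)
      fix x assume "x \<in> space M"
      from lim.hyps(3)[OF this, of i] show "norm \<bar>s i x - f x\<bar> \<le> 3 * \<bar>f x\<bar>"
        unfolding real_norm_def by linarith
    qed
  qed (use lim in auto)
  then have "\<forall>\<^sub>F i in sequentially. (\<integral>x. \<bar>s i x - f x\<bar> \<partial>M) < e / 2"
    using lim.prems by (intro order_tendstoD) auto
  then obtain i where i: "(\<integral>x. \<bar>s i x - f x\<bar> \<partial>M) < e / 2"
    by (auto simp: eventually_sequentially)
  obtain p where p: "p \<in> P" "(\<integral>x. \<bar>p x - s i x\<bar> \<partial>M) < e / 2"
    using lim.IH[of "e/2" i] lim.prems by auto
  have ip: "integrable M p"
    using p P_moments all_moments_integrable by blast
  have "(\<integral>x. \<bar>p x - f x\<bar> \<partial>M) \<le> (\<integral>x. \<bar>p x - s i x\<bar> + \<bar>s i x - f x\<bar> \<partial>M)"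
    by (rule integral_mono) (use ip lim.hyps in auto)
  also have "\<dots> = (\<integral>x. \<bar>p x - s i x\<bar> \<partial>M) + (\<integral>x. \<bar>s i x - f x\<bar> \<partial>M)"
    by (rule Bochner_Integration.integral_add) (use ip lim.hyps in auto)
  finally show ?case
    using p i by (intro bexI[of _ p]) auto
qed

end

subsection \<open>Representation of positive functionals\<close>

locale L1_functional = dense_moment_algebra +
  fixes l :: "('a \<Rightarrow> real) \<Rightarrow> real" and C :: real
  assumes l_add: "p \<in> P \<Longrightarrow> q \<in> P \<Longrightarrow> l (\<lambda>x. p x + q x) = l p + l q"
    and l_cmult: "p \<in> P \<Longrightarrow> l (\<lambda>x. a * p x) = a * l p"
    and l_bound: "p \<in> P \<Longrightarrow> \<bar>l p\<bar> \<le> C * (\<integral>x. \<bar>p x\<bar> \<partial>M)"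
    and C_nonneg: "0 \<le> C"
begin

lemma P_integrable: "p \<in> P \<Longrightarrow> integrable M p"
  using P_moments all_moments_integrable by blast

lemma l_diff_bound:
  assumes "p \<in> P" "q \<in> P"
  shows "\<bar>l p - l q\<bar> \<le> C * (\<integral>x. \<bar>p x - q x\<bar> \<partial>M)"
proof -
  have "(\<lambda>x. - 1 * q x) \<in> P"
    using assms by (intro P_cmult)
  from P_add[OF assms(1) this] l_add[OF assms(1) this] l_bound[of "\<lambda>x. p x + - 1 * q x"]
    l_cmult[OF assms(2), of "- 1"]
  show ?thesis by simp
qed

definition approximates :: "(nat \<Rightarrow> 'a \<Rightarrow> real) \<Rightarrow> ('a \<Rightarrow> real) \<Rightarrow> bool" where
  "approximates p h \<longleftrightarrow> range p \<subseteq> P \<and> (\<lambda>n. \<integral>x. \<bar>p n x - h x\<bar> \<partial>M) \<longlonglongrightarrow> 0"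

lemma approximates_exists:
  assumes "integrable M h"
  obtains p where "approximates p h"
proof -
  have "\<exists>p. p \<in> P \<and> (\<integral>x. \<bar>p x - h x\<bar> \<partial>M) < inverse (real (Suc n))" for n
    using L1_approx[OF assms, of "inverse (real (Suc n))"] by auto
  then obtain p where p: "\<And>n. p n \<in> P" "\<And>n. (\<integral>x. \<bar>p n x - h x\<bar> \<partial>M) < inverse (real (Suc n))"
    by metis
  have "(\<lambda>n. \<integral>x. \<bar>p n x - h x\<bar> \<partial>M) \<longlonglongrightarrow> 0"
    by (rule tendsto_sandwich[OF _ _ tendsto_const LIMSEQ_inverse_real_of_nat])
       (auto intro!: always_eventually less_imp_le p(2) simp del: of_nat_Suc)
  with p(1) show thesis
    by (intro that[of p]) (auto simp: approximates_def)
qed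

lemma L1_triangle:
  fixes f g h :: "'a \<Rightarrow> real"
  assumes "integrable M f" "integrable M g" "integrable M h"
  shows "(\<integral>x. \<bar>f x - h x\<bar> \<partial>M) \<le> (\<integral>x. \<bar>f x - g x\<bar> \<partial>M) + (\<integral>x. \<bar>g x - h x\<bar> \<partial>M)"
proof -
  have "(\<integral>x. \<bar>f x - h x\<bar> \<partial>M) \<le> (\<integral>x. \<bar>f x - g x\<bar> + \<bar>g x - h x\<bar> \<partial>M)"
    by (rule integral_mono) (use assms in auto)
  also have "\<dots> = (\<integral>x. \<bar>f x - g x\<bar> \<partial>M) + (\<integral>x. \<bar>g x - h x\<bar> \<partial>M)"
    by (rule Bochner_Integration.integral_add) (use assms in auto)
  finally show ?thesis .
qed

text \<open>The value is pinned by inequalities against all of \<open>P\<close> instead of a chosen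
  sequence; for integrable h density makes it unique. All later facts go through
  \<open>L1_extension_close\<close>.\<close>

definition L1_extension :: "('a \<Rightarrow> real) \<Rightarrow> real" where
  "L1_extension h = (SOME x. \<forall>p\<in>P. \<bar>l p - x\<bar> \<le> C * (\<integral>x. \<bar>p x - h x\<bar> \<partial>M))"

text \<open>A number with the required property exists: along an approximating sequence the values
  of \<open>l\<close> are Cauchy, and their limit y satisfies the inequality for all q in
  \<open>P\<close> simultaneously.\<close>

lemma L1_extension_close:
  assumes h: "integrable M h" and q: "q \<in> P"
  shows "\<bar>l q - L1_extension h\<bar> \<le> C * (\<integral>x. \<bar>q x - h x\<bar> \<partial>M)"
proof -
  obtain p where "approximates p h"
    using approximates_exists[OF h] .
  then have p: "\<And>n. p n \<in> P" and lim: "(\<lambda>n. \<integral>x. \<bar>p n x - h x\<bar> \<partial>M) \<longlonglongrightarrow> 0"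
    by (auto simp: approximates_def)
  have sym: "(\<integral>x. \<bar>h x - p n x\<bar> \<partial>M) = (\<integral>x. \<bar>p n x - h x\<bar> \<partial>M)" for n
    by (simp add: abs_minus_commute)
  have close: "\<bar>l q - l (p n)\<bar> \<le> C * ((\<integral>x. \<bar>q x - h x\<bar> \<partial>M) + (\<integral>x. \<bar>p n x - h x\<bar> \<partial>M))"
    if "q \<in> P" for q n
    using l_diff_bound[OF that p, of n] L1_triangle[OF P_integrable[OF that] h P_integrable[OF p], of n]
      C_nonneg by (simp add: sym) (meson mult_left_mono order_trans)
  have "Cauchy (\<lambda>n. l (p n))"
    unfolding Cauchy_altdef2
  proof (intro allI impI)
    fix e :: real assume "e > 0"
    have "(\<lambda>n. C * (\<integral>x. \<bar>p n x - h x\<bar> \<partial>M)) \<longlonglongrightarrow> C * 0"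
      by (intro tendsto_intros lim)
    then have "\<forall>\<^sub>F n in sequentially. C * (\<integral>x. \<bar>p n x - h x\<bar> \<partial>M) < e / 2"
      using \<open>e > 0\<close> by (intro order_tendstoD) auto
    then obtain N where N: "\<And>n. n \<ge> N \<Longrightarrow> C * (\<integral>x. \<bar>p n x - h x\<bar> \<partial>M) < e / 2"
      by (auto simp: eventually_sequentially)
    show "\<exists>N. \<forall>n\<ge>N. dist (l (p n)) (l (p N)) < e"
    proof (intro exI allI impI)
      fix n assume "N \<le> n"
      then show "dist (l (p n)) (l (p N)) < e"
        using close[OF p, of n N] N[of n] N[of N] by (simp add: dist_real_def distrib_left)
    qed
  qed
  then obtain y where y: "(\<lambda>n. l (p n)) \<longlonglongrightarrow> y"
    by (auto simp: Cauchy_convergent_iff convergent_def)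
  have "\<bar>l q - y\<bar> \<le> C * (\<integral>x. \<bar>q x - h x\<bar> \<partial>M)" if "q \<in> P" for q
  proof (rule LIMSEQ_le)
    show "(\<lambda>n. \<bar>l q - l (p n)\<bar>) \<longlonglongrightarrow> \<bar>l q - y\<bar>"
      by (intro tendsto_intros y)
    have "(\<lambda>n. C * ((\<integral>x. \<bar>q x - h x\<bar> \<partial>M) + (\<integral>x. \<bar>p n x - h x\<bar> \<partial>M)))
        \<longlonglongrightarrow> C * ((\<integral>x. \<bar>q x - h x\<bar> \<partial>M) + 0)"
      by (intro tendsto_intros lim)
    then show "(\<lambda>n. C * ((\<integral>x. \<bar>q x - h x\<bar> \<partial>M) + (\<integral>x. \<bar>p n x - h x\<bar> \<partial>M)))
        \<longlonglongrightarrow> C * (\<integral>x. \<bar>q x - h x\<bar> \<partial>M)"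
      by simp
  qed (use close[OF that] in auto)
  then have "\<forall>p\<in>P. \<bar>l p - L1_extension h\<bar> \<le> C * (\<integral>x. \<bar>p x - h x\<bar> \<partial>M)"
    unfolding L1_extension_def
    by (rule someI[of "\<lambda>x. \<forall>p\<in>P. \<bar>l p - x\<bar> \<le> C * (\<integral>x. \<bar>p x - h x\<bar> \<partial>M)" y, OF ballI])
  with q show ?thesis by simp
qed

lemma L1_extension_eq: "p \<in> P \<Longrightarrow> L1_extension p = l p"
  using L1_extension_close[OF P_integrable, of p p] by simp

lemma L1_extension_tendsto:
  assumes "integrable M h" "approximates p h"
  shows "(\<lambda>n. l (p n)) \<longlonglongrightarrow> L1_extension h"
proof (rule LIM_zero_cancel, rule Lim_null_comparison)
  show "\<forall>\<^sub>F n in sequentially. norm (l (p n) - L1_extension h) \<le> C * (\<integral>x. \<bar>p n x - h x\<bar> \<partial>M)"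
    using assms by (intro always_eventually allI) (auto simp: approximates_def intro: L1_extension_close)
  have "(\<lambda>n. C * (\<integral>x. \<bar>p n x - h x\<bar> \<partial>M)) \<longlonglongrightarrow> C * 0"
    using assms by (intro tendsto_intros) (auto simp: approximates_def)
  then show "(\<lambda>n. C * (\<integral>x. \<bar>p n x - h x\<bar> \<partial>M)) \<longlonglongrightarrow> 0" by simp
qed

lemma L1_extension_add:
  assumes h: "integrable M h" and g: "integrable M g"
  shows "L1_extension (\<lambda>x. h x + g x) = L1_extension h + L1_extension g"
proof -
  obtain p q where p: "approximates p h" and q: "approximates q g"
    using approximates_exists h g by metis
  have P: "p n \<in> P" "q n \<in> P" for n
    using p q by (auto simp: approximates_def)
  have "approximates (\<lambda>n x. p n x + q n x) (\<lambda>x. h x + g x)"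
    unfolding approximates_def
  proof
    show "(\<lambda>n. \<integral>x. \<bar>p n x + q n x - (h x + g x)\<bar> \<partial>M) \<longlonglongrightarrow> 0"
    proof (rule tendsto_0_integral_sandwich)
      show "\<bar>p n x + q n x - (h x + g x)\<bar> \<le> \<bar>p n x - h x\<bar> + \<bar>q n x - g x\<bar>" for n x
        by linarith
      show "integrable M (\<lambda>x. \<bar>p n x - h x\<bar> + \<bar>q n x - g x\<bar>)" for n
        using P_integrable[OF P(1)] P_integrable[OF P(2)] h g by auto
      have "(\<lambda>n. (\<integral>x. \<bar>p n x - h x\<bar> \<partial>M) + (\<integral>x. \<bar>q n x - g x\<bar> \<partial>M)) \<longlonglongrightarrow> 0 + 0"
        using p q by (intro tendsto_add) (auto simp: approximates_def)
      then show "(\<lambda>n. \<integral>x. \<bar>p n x - h x\<bar> + \<bar>q n x - g x\<bar> \<partial>M) \<longlonglongrightarrow> 0"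
        using P_integrable[OF P(1)] P_integrable[OF P(2)] h g by simp
    qed simp
  qed (use P_add P in auto)
  then have "(\<lambda>n. l (\<lambda>x. p n x + q n x)) \<longlonglongrightarrow> L1_extension (\<lambda>x. h x + g x)"
    by (rule L1_extension_tendsto[rotated]) (use h g in auto)
  moreover have "(\<lambda>n. l (\<lambda>x. p n x + q n x)) \<longlonglongrightarrow> L1_extension h + L1_extension g"
    using tendsto_add[OF L1_extension_tendsto[OF h p] L1_extension_tendsto[OF g q]] P by (simp add: l_add)
  ultimately show ?thesis
    by (rule LIMSEQ_unique)
qed

lemma L1_extension_cmult:
  assumes h: "integrable M h"
  shows "L1_extension (\<lambda>x. a * h x) = a * L1_extension h"
proof -
  obtain p where p: "approximates p h"
    using approximates_exists h by metis
  have P: "p n \<in> P" for n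
    using p by (auto simp: approximates_def)
  have "approximates (\<lambda>n x. a * p n x) (\<lambda>x. a * h x)"
    unfolding approximates_def
  proof
    have "(\<lambda>n. \<bar>a\<bar> * (\<integral>x. \<bar>p n x - h x\<bar> \<partial>M)) \<longlonglongrightarrow> \<bar>a\<bar> * 0"
      using p by (intro tendsto_intros) (auto simp: approximates_def)
    moreover have "\<bar>a * p n x - a * h x\<bar> = \<bar>a\<bar> * \<bar>p n x - h x\<bar>" for n x
      by (simp add: abs_mult[symmetric] right_diff_distrib)
    ultimately show "(\<lambda>n. \<integral>x. \<bar>a * p n x - a * h x\<bar> \<partial>M) \<longlonglongrightarrow> 0"
      by simp
  qed (use P_cmult P in auto)
  then have "(\<lambda>n. l (\<lambda>x. a * p n x)) \<longlonglongrightarrow> L1_extension (\<lambda>x. a * h x)"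
    by (rule L1_extension_tendsto[rotated]) (use h in auto)
  moreover have "(\<lambda>n. l (\<lambda>x. a * p n x)) \<longlonglongrightarrow> a * L1_extension h"
    using tendsto_mult_left[OF L1_extension_tendsto[OF h p], of a] P by (simp add: l_cmult)
  ultimately show ?thesis
    by (rule LIMSEQ_unique)
qed

lemma L1_extension_bound:
  assumes h: "integrable M h"
  shows "\<bar>L1_extension h\<bar> \<le> C * (\<integral>x. \<bar>h x\<bar> \<partial>M)"
proof -
  have "\<bar>l (\<lambda>_. 0) - L1_extension h\<bar> \<le> C * (\<integral>x. \<bar>0 - h x\<bar> \<partial>M)"
    by (rule L1_extension_close[OF h P_const])
  moreover have "l (\<lambda>_. 0) = 0"
    using l_cmult[OF P_const, of 0] by simp
  ultimately show ?thesis by simp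
qed

lemma L1_extension_diff_bound:
  assumes h: "integrable M h" and g: "integrable M g"
  shows "\<bar>L1_extension h - L1_extension g\<bar> \<le> C * (\<integral>x. \<bar>h x - g x\<bar> \<partial>M)"
proof -
  have "L1_extension (\<lambda>x. h x + - 1 * g x) = L1_extension h + - 1 * L1_extension g"
    using g by (subst L1_extension_add[OF h]) (auto simp: L1_extension_cmult[OF g, of "- 1", simplified])
  moreover have "\<bar>L1_extension (\<lambda>x. h x + - 1 * g x)\<bar> \<le> C * (\<integral>x. \<bar>h x + - 1 * g x\<bar> \<partial>M)"
    by (rule L1_extension_bound) (use h g in auto)
  ultimately show ?thesis by simp
qed

end

locale positive_L1_functional = L1_functional +
  assumes l_square: "p \<in> P \<Longrightarrow> 0 \<le> l (\<lambda>x. p x * p x)"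
begin

lemma integrable_indicator: "A \<in> sets M \<Longrightarrow> integrable M (indicator A :: _ \<Rightarrow> real)"
  by (simp add: integrable_indicator_iff emeasure_eq_measure)

text \<open>Indicators are idempotent: if F_n tends to the indicator in all moments, then F_n^2
  tends to the same indicator in L^1, and \<open>l\<close> is nonnegative on F_n^2.\<close>

lemma L1_extension_indicator_nonneg:
  assumes "A \<in> sets M"
  shows "0 \<le> L1_extension (indicator A)"
proof -
  obtain F where F: "range F \<subseteq> P" "tends_moments M F (indicator A)"
    using dense[OF assms] by (auto simp: moment_closure_def)
  have "tends_moments M (\<lambda>n x. F n x * F n x) (\<lambda>x. indicator A x * indicator A x)"
    by (rule tends_moments_mult[OF F(2) F(2)])
  moreover have "(\<lambda>x. indicator A x * indicator A x) = (indicator A :: _ \<Rightarrow> real)"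
    by (auto simp: indicator_def)
  ultimately have "approximates (\<lambda>n x. F n x * F n x) (indicator A)"
    unfolding approximates_def using F(1) by (auto intro: P_mult tends_moments_L1)
  then have "(\<lambda>n. l (\<lambda>x. F n x * F n x)) \<longlonglongrightarrow> L1_extension (indicator A)"
    by (rule L1_extension_tendsto[OF integrable_indicator[OF assms]])
  then show ?thesis
    by (rule LIMSEQ_le_const) (use F(1) l_square in auto)
qed

section \<open>The representing measure and its integrals\<close>

definition representing_measure :: "'a measure" where
  "representing_measure = measure_of (space M) (sets M) (\<lambda>A. ennreal (L1_extension (indicator A)))"

lemma sets_representing_measure [simp, measurable_cong]: "sets representing_measure = sets M"
  by (simp add: representing_measure_def)

lemma space_representing_measure [simp]: "space representing_measure = space M"
  by (simp add: representing_measure_def)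

text \<open>Finite additivity is linearity. Countable additivity comes from L^1 continuity, because
  the indicators of the finite unions converge in L^1 to that of the whole union.\<close>

lemma L1_extension_indicator_sums:
  assumes A: "range A \<subseteq> sets M" and disj: "disjoint_family A"
  shows "(\<lambda>i. L1_extension (indicator (A i))) sums L1_extension (indicator (\<Union>i. A i))"
proof -
  have meas [measurable]: "A i \<in> sets M" for i
    using A by auto
  have "(\<Sum>i<n. L1_extension (indicator (A i))) = L1_extension (indicator (\<Union>i<n. A i))" for n
  proof (induction n)
    case 0
    show ?case
      using L1_extension_cmult[of "\<lambda>_. 0" 0] by (simp add: indicator_def[abs_def])
  next
    case (Suc n)
    have "A n \<inter> A i = {}" if "i < n" for i
      using disj that by (auto simp: disjoint_family_on_def)
    then have "A n \<inter> (\<Union>i<n. A i) = {}"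
      by blast
    then have "indicator (\<Union>i<Suc n. A i) = (\<lambda>x. indicator (\<Union>i<n. A i) x + indicator (A n) x :: real)"
      by (auto simp: indicator_def fun_eq_iff less_Suc_eq split: if_splits)
    then show ?case
      using Suc by (simp add: L1_extension_add integrable_indicator)
  qed
  moreover have "(\<lambda>n. L1_extension (indicator (\<Union>i<n. A i))) \<longlonglongrightarrow> L1_extension (indicator (\<Union>i. A i))"
  proof (rule LIM_zero_cancel, rule Lim_null_comparison)
    show "\<forall>\<^sub>F n in sequentially. norm (L1_extension (indicator (\<Union>i<n. A i)) - L1_extension (indicator (\<Union>i. A i)))
        \<le> C * (\<integral>x. \<bar>indicator (\<Union>i<n. A i) x - indicator (\<Union>i. A i) x\<bar> \<partial>M)"
      by (auto intro!: always_eventually L1_extension_diff_bound integrable_indicator)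
    have "tends_moments M (\<lambda>n. indicator (\<Union>i<n. A i)) (indicator (\<Union>i. A i))"
      by (rule tends_moments_dominated[OF all_moments_const[of 1]])
         (auto intro: LIMSEQ_indicator_UN)
    from tendsto_mult_left[OF tends_moments_L1[OF this], of C]
    show "(\<lambda>n. C * (\<integral>x. \<bar>indicator (\<Union>i<n. A i) x - indicator (\<Union>i. A i) x\<bar> \<partial>M)) \<longlonglongrightarrow> 0"
      by simp
  qed
  ultimately show ?thesis
    by (simp add: sums_def)
qed

lemma emeasure_representing_measure:
  assumes "A \<in> sets M"
  shows "emeasure representing_measure A = ennreal (L1_extension (indicator A))"
proof (rule emeasure_measure_of[OF representing_measure_def])
  have "L1_extension (indicator {}) = 0"
    using L1_extension_cmult[of "\<lambda>_. 0" 0] by (simp add: indicator_def[abs_def])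
  then show "positive (sets representing_measure) (\<lambda>A. ennreal (L1_extension (indicator A)))"
    by (simp add: positive_def)
  show "countably_additive (sets representing_measure) (\<lambda>A. ennreal (L1_extension (indicator A)))"
    unfolding countably_additive_def
    by (auto intro!: suminf_ennreal_eq L1_extension_indicator_sums L1_extension_indicator_nonneg)
qed (use assms sets.sets_into_space in auto)

lemma emeasure_representing_measure_le: "A \<in> sets M \<Longrightarrow> emeasure representing_measure A \<le> ennreal C * emeasure M A"
proof -
  assume A: "A \<in> sets M"
  have "L1_extension (indicator A) \<le> C * measure M A"
    using L1_extension_bound[OF integrable_indicator[OF A]] A by simp
  then show ?thesis
    using C_nonneg by (simp add: emeasure_representing_measure A emeasure_eq_measure ennreal_mult[symmetric] ennreal_leI)
qed

text \<open>The setwise domination by \<open>C\<close> times \<open>M\<close> is read as an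
  inequality of measures, which integrals respect. It makes every \<open>M\<close>-integrable
  function integrable for the representing measure.\<close>

lemma nn_integral_representing_measure_le: "(\<integral>\<^sup>+x. f x \<partial>representing_measure) \<le> ennreal C * (\<integral>\<^sup>+x. f x \<partial>M)" if "f \<in> borel_measurable M"
proof -
  have "representing_measure \<le> scale_measure (ennreal C) M"
  proof (rule less_eq_measure.intros(3))
    show "emeasure representing_measure \<le> emeasure (scale_measure (ennreal C) M)"
    proof (rule le_funI)
      fix A
      show "emeasure representing_measure A \<le> emeasure (scale_measure (ennreal C) M) A"
        by (cases "A \<in> sets M") (simp_all add: emeasure_representing_measure_le emeasure_notin_sets)
    qed
  qed (simp_all add: space_scale_measure)
  then have "(\<integral>\<^sup>+x. f x \<partial>representing_measure) \<le> (\<integral>\<^sup>+x. f x \<partial>scale_measure (ennreal C) M)"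
    by (rule nn_integral_mono_measure[rotated]) simp
  then show ?thesis
    using that by (simp add: nn_integral_scale_measure)
qed

lemma integrable_representing_measure:
  fixes f :: "'a \<Rightarrow> real"
  assumes "integrable M f"
  shows "integrable representing_measure f"
proof (rule integrableI_bounded)
  show "f \<in> borel_measurable representing_measure"
    using assms by simp
  have "(\<integral>\<^sup>+x. norm (f x) \<partial>representing_measure) \<le> ennreal C * (\<integral>\<^sup>+x. norm (f x) \<partial>M)"
    by (rule nn_integral_representing_measure_le) (use assms in auto)
  also have "\<dots> < \<infinity>"
    using assms by (auto simp: integrable_iff_bounded ennreal_mult_less_top)
  finally show "(\<integral>\<^sup>+x. norm (f x) \<partial>representing_measure) < \<infinity>" .
qed

text \<open>Both sides agree on indicators by construction, are linear, and pass to dominated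
  limits: the left one by dominated convergence, the right one by the L^1 bound.\<close>

lemma integral_representing_measure:
  assumes "integrable M f"
  shows "(\<integral>x. f x \<partial>representing_measure) = L1_extension f"
  using assms
proof (induction rule: integrable_induct)
  case (base A c)
  have "measure representing_measure A = L1_extension (indicator A)"
    using base by (simp add: measure_def emeasure_representing_measure L1_extension_indicator_nonneg)
  moreover have "emeasure representing_measure A < \<infinity>"
    using base by (simp add: emeasure_representing_measure)
  ultimately show ?case
    using base L1_extension_cmult[OF integrable_indicator[of A], of c]
    by (simp add: mult.commute)
next
  case (add f g)
  then show ?case
    by (simp add: L1_extension_add integrable_representing_measure)
next
  case (lim f s)
  have "(\<lambda>i. \<integral>x. s i x \<partial>representing_measure) \<longlonglongrightarrow> (\<integral>x. f x \<partial>representing_measure)"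
    by (rule integral_dominated_convergence[where w = "\<lambda>x. 2 * norm (f x)"])
       (use lim.hyps in \<open>auto intro!: AE_I2 integrable_representing_measure\<close>)
  moreover have "(\<lambda>i. L1_extension (s i)) \<longlonglongrightarrow> L1_extension f"
  proof (rule LIM_zero_cancel, rule Lim_null_comparison)
    show "\<forall>\<^sub>F i in sequentially. norm (L1_extension (s i) - L1_extension f) \<le> C * (\<integral>x. \<bar>s i x - f x\<bar> \<partial>M)"
      using lim.hyps by (auto intro!: always_eventually L1_extension_diff_bound)
    have "(\<lambda>i. \<integral>x. \<bar>s i x - f x\<bar> \<partial>M) \<longlonglongrightarrow> (\<integral>x. 0 \<partial>M)"
    proof (rule integral_dominated_convergence)
      show "integrable M (\<lambda>x. 3 * \<bar>f x\<bar>)"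
        using lim by auto
      show "AE x in M. (\<lambda>i. \<bar>s i x - f x\<bar>) \<longlonglongrightarrow> 0"
        using lim.hyps(2) by (intro AE_I2 tendsto_rabs_zero LIM_zero)
      show "AE x in M. norm \<bar>s i x - f x\<bar> \<le> 3 * \<bar>f x\<bar>" for i
      proof (rule AE_I2)
        fix x assume "x \<in> space M"
        from lim.hyps(3)[OF this, of i] show "norm \<bar>s i x - f x\<bar> \<le> 3 * \<bar>f x\<bar>"
          unfolding real_norm_def by linarith
      qed
    qed (use lim in auto)
    from tendsto_mult_left[OF this, of C]
    show "(\<lambda>i. C * (\<integral>x. \<bar>s i x - f x\<bar> \<partial>M)) \<longlonglongrightarrow> 0" by simp
  qed
  ultimately show ?case
    using lim.IH LIMSEQ_unique by simp
qed

end

lemma (in L1_functional) l_sum: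
  "(\<And>i. i \<in> I \<Longrightarrow> p i \<in> P) \<Longrightarrow> l (\<lambda>x. \<Sum>i\<in>I. p i x) = (\<Sum>i\<in>I. l (p i))"
proof (induction I rule: infinite_finite_induct)
  case (insert i I)
  then have "p i \<in> P" "(\<lambda>x. \<Sum>i\<in>I. p i x) \<in> P"
    by (auto intro: P_sum)
  from l_add[OF this] insert show ?case by simp
qed (use l_cmult[OF P_const, of 0] in auto)

context positive_L1_functional
begin

text \<open>Localisation to A = {f < 0}: if F_n tends to the indicator of A in all moments, then
  F_n^2 f tends in L^1 to f restricted to A. So the integral of f over A is nonnegative, although f
  < 0 there, and A must be a null set.\<close>

lemma AE_representing_measure_nonneg:
  assumes f: "f \<in> P" and pos: "\<And>p. p \<in> P \<Longrightarrow> 0 \<le> l (\<lambda>x. p x * p x * f x)"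
  shows "AE x in representing_measure. 0 \<le> f x"
proof -
  have f_mom: "f \<in> all_moments M"
    using f P_moments by auto
  have [measurable]: "f \<in> borel_measurable M"
    by (rule all_moments_measurable[OF f_mom])
  define A where "A = {x \<in> space M. f x < 0}"
  have A: "A \<in> sets M"
    unfolding A_def by measurable
  obtain F where F: "range F \<subseteq> P" "tends_moments M F (indicator A)"
    using dense[OF A] by (auto simp: moment_closure_def)
  have int: "integrable M (\<lambda>x. indicator A x * indicator A x * f x)"
    using F(2) f_mom unfolding tends_moments_def
    by (intro all_moments_integrable all_moments_mult) auto
  have "tends_moments M (\<lambda>n x. F n x * F n x * f x) (\<lambda>x. indicator A x * indicator A x * f x)"
    by (intro tends_moments_mult tends_moments_const F f_mom)
  from tends_moments_L1[OF this]
  have "approximates (\<lambda>n x. F n x * F n x * f x) (\<lambda>x. indicator A x * indicator A x * f x)"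
    using P_mult[OF P_mult f] F(1) by (simp add: approximates_def image_subset_iff)
  from L1_extension_tendsto[OF int this] have "0 \<le> L1_extension (\<lambda>x. indicator A x * indicator A x * f x)"
    by (rule LIMSEQ_le_const) (use F(1) pos in auto)
  then have ge: "0 \<le> (\<integral>x. indicator A x * indicator A x * f x \<partial>representing_measure)"
    by (simp only: integral_representing_measure[OF int])
  have neg: "0 \<le> - (indicator A x * indicator A x * f x)" for x
    by (auto simp: indicator_def A_def)
  have "(\<integral>x. - (indicator A x * indicator A x * f x) \<partial>representing_measure) = 0"
  proof (rule antisym)
    show "(\<integral>x. - (indicator A x * indicator A x * f x) \<partial>representing_measure) \<le> 0"
      using ge by simp
    show "0 \<le> (\<integral>x. - (indicator A x * indicator A x * f x) \<partial>representing_measure)"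
      by (rule Bochner_Integration.integral_nonneg[OF neg])
  qed
  then have "AE x in representing_measure. - (indicator A x * indicator A x * f x) = 0"
    by (subst (asm) integral_nonneg_eq_0_iff_AE)
       (use neg integrable_representing_measure[OF int] in auto)
  then show ?thesis
    by (rule AE_mp) (auto intro!: AE_I2 simp: A_def indicator_def split: if_splits)
qed

lemma prob_space_representing_measure:
  assumes "l (\<lambda>_. 1) = 1"
  shows "prob_space representing_measure"
proof -
  interpret representing_measure: finite_measure representing_measure
    by (rule finite_measureI) (simp add: emeasure_representing_measure)
  have "measure representing_measure (space representing_measure) = 1"
    using integral_representing_measure[of "\<lambda>_. 1"] L1_extension_eq[OF P_const, of 1] assms by simp
  then show ?thesis
    by (intro prob_spaceI) (simp add: representing_measure.emeasure_eq_measure)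
qed

end

subsection \<open>Gaussian increments and polynomials of the path\<close>

text \<open>Completing the square: the exponential factor shifts the Gaussian mean to a \<sigma>^2,
  at the price of the constant exp (a^2 \<sigma>^2 / 2).\<close>

lemma integrable_normal_density_exp:
  assumes "0 < \<sigma>"
  shows "integrable lborel (\<lambda>x. normal_density 0 \<sigma> x * exp (a * x))"
proof -
  have "normal_density 0 \<sigma> x * exp (a * x) =
      exp (a\<^sup>2 * \<sigma>\<^sup>2 / 2) * normal_density (a * \<sigma>\<^sup>2) \<sigma> x" for x
  proof -
    have "- (x - 0)\<^sup>2 / (2 * \<sigma>\<^sup>2) + a * x = a\<^sup>2 * \<sigma>\<^sup>2 / 2 + - (x - a * \<sigma>\<^sup>2)\<^sup>2 / (2 * \<sigma>\<^sup>2)"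
      using assms by (simp add: field_simps power2_eq_square)
    then show ?thesis
      by (simp add: normal_density_def exp_add[symmetric] mult.assoc mult.left_commute)
  qed
  then show ?thesis
    using integrable_normal_density[OF assms] by simp
qed

text \<open>By exp (k |x|) \<le> exp (k x) + exp (-k x), the two-sided exponential reduces to
  exponential moments of both signs.\<close>

lemma exp_abs_normal_all_moments:
  assumes D: "distributed M lborel X (normal_density 0 \<sigma>)" and "0 < \<sigma>"
  shows "(\<lambda>x. exp \<bar>X x\<bar>) \<in> all_moments M"
proof -
  have [measurable]: "X \<in> borel_measurable M"
    using distributed_measurable[OF D] by simp
  have "integrable M (\<lambda>x. \<bar>exp \<bar>X x\<bar>\<bar> ^ k)" for k
  proof (rule Bochner_Integration.integrable_bound)
    have i: "integrable M (\<lambda>x. exp (a * X x))" for a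
      using distributed_integrable[OF D, of "\<lambda>x. exp (a * x)"]
        integrable_normal_density_exp[OF assms(2)] by simp
    show "integrable M (\<lambda>x. exp (real k * X x) + exp (- real k * X x))"
      by (intro Bochner_Integration.integrable_add i)
    have "exp \<bar>X x\<bar> ^ k \<le> exp (real k * X x) + exp (- real k * X x)" for x
      by (cases "0 \<le> X x") (auto simp: exp_of_nat_mult[symmetric])
    then show "AE x in M. norm (\<bar>exp \<bar>X x\<bar>\<bar> ^ k) \<le> norm (exp (real k * X x) + exp (- real k * X x))"
      by (intro AE_I2) (auto intro: order_trans)
  qed simp
  then show ?thesis
    by (simp add: all_moments_def)
qed

lemma abs_le_exp_abs: "\<bar>y\<bar> \<le> exp \<bar>y\<bar>" for y :: real
  using exp_ge_add_one_self[of "\<bar>y\<bar>"] by linarith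

lemma all_moments_cong:
  assumes "\<And>x. x \<in> space M \<Longrightarrow> f x = g x"
  shows "f \<in> all_moments M \<longleftrightarrow> g \<in> all_moments M"
  unfolding all_moments_def mem_Collect_eq
  using assms by (intro conj_cong measurable_cong all_cong1 Bochner_Integration.integrable_cong) auto

text \<open>Independence passes to the smaller sigma-algebras generated by X and Y. This links the
  independence of increments in \<open>brownian_motion\<close> with the product rule for
  expectations.\<close>

lemma (in prob_space) indep_set_imp_indep_var:
  assumes ind: "indep_set (sets F) (sets G)"
    and X: "X \<in> borel_measurable F" and Y: "Y \<in> borel_measurable G"
    and sp: "space F = space M" "space G = space M"
  shows "indep_var borel X borel Y"
proof -
  have sub: "sets F \<subseteq> events" "sets G \<subseteq> events"
    using ind by (auto simp: indep_sets2_eq)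
  have "subalgebra M F" "subalgebra M G"
    using sub sp by (auto simp: subalgebra_def)
  then have rv: "random_variable borel X" "random_variable borel Y"
    using X Y measurable_from_subalg by blast+
  have gen: "sigma_sets (space M) {X -` A \<inter> space M |A. A \<in> sets borel} \<subseteq> sets F"
      "sigma_sets (space M) {Y -` A \<inter> space M |A. A \<in> sets borel} \<subseteq> sets G"
    using sets.sigma_sets_subset[of "{X -` A \<inter> space F |A. A \<in> sets borel}" F]
      sets.sigma_sets_subset[of "{Y -` A \<inter> space G |A. A \<in> sets borel}" G]
      measurable_sets[OF X] measurable_sets[OF Y] unfolding sp by blast+
  show ?thesis
    unfolding indep_var_eq
  proof (intro conjI rv)
    show "indep_set (sigma_sets (space M) {X -` A \<inter> space M |A. A \<in> sets borel})
       (sigma_sets (space M) {Y -` A \<inter> space M |A. A \<in> sets borel})"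
      using ind gen unfolding indep_sets2_eq by blast
  qed
qed

section \<open>Polynomials in the coordinates of a path\<close>

lemma poly_eval_sum: "poly_eval (\<Sum>i\<in>I. p i) y = (\<Sum>i\<in>I. poly_eval (p i) y)"
  by (induction I rule: infinite_finite_induct) (auto simp: poly_eval_add, auto simp: poly_eval_def)

lemma poly_times_add: "poly_times (p + q) \<subseteq> poly_times p \<union> poly_times q"
  using Poly_Mapping.keys_add[of p q] unfolding poly_times_def by blast

lemma poly_times_sum: "poly_times (\<Sum>i\<in>I. p i) \<subseteq> (\<Union>i\<in>I. poly_times (p i))"
proof (induction I rule: infinite_finite_induct)
  case (insert i I)
  then show ?case using poly_times_add[of "p i" "sum p I"] by auto
qed (auto simp: poly_times_def)

lemma poly_times_single: "poly_times (Poly_Mapping.single \<alpha> a) \<subseteq> Poly_Mapping.keys \<alpha>"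
  by (auto simp: poly_times_def split: if_splits)

text \<open>The product is written out as a double sum over pairs of monomials, so that its times
  and its values can be read off term by term.\<close>

lemma poly_eval_mult_exists:
  "\<exists>r. poly_times r \<subseteq> poly_times p \<union> poly_times q \<and> (\<forall>y. poly_eval r y = poly_eval p y * poly_eval q y)"
proof (intro exI conjI allI)
  let ?s = "\<lambda>\<alpha> \<beta>. Poly_Mapping.single (\<alpha> + \<beta>) (Poly_Mapping.lookup p \<alpha> * Poly_Mapping.lookup q \<beta>)"
  let ?r = "\<Sum>\<alpha>\<in>Poly_Mapping.keys p. \<Sum>\<beta>\<in>Poly_Mapping.keys q. ?s \<alpha> \<beta>"
  have "poly_times ?r \<subseteq> (\<Union>\<alpha>\<in>Poly_Mapping.keys p. \<Union>\<beta>\<in>Poly_Mapping.keys q. poly_times (?s \<alpha> \<beta>))"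
    using poly_times_sum[of "?s _" "Poly_Mapping.keys q"]
    by (intro order_trans[OF poly_times_sum] UN_mono) auto
  also have "\<dots> \<subseteq> (\<Union>\<alpha>\<in>Poly_Mapping.keys p. \<Union>\<beta>\<in>Poly_Mapping.keys q.
      Poly_Mapping.keys \<alpha> \<union> Poly_Mapping.keys \<beta>)"
    by (intro UN_mono order_refl order_trans[OF poly_times_single Poly_Mapping.keys_add])
  also have "\<dots> \<subseteq> poly_times p \<union> poly_times q"
    by (auto simp: poly_times_def)
  finally show "poly_times ?r \<subseteq> poly_times p \<union> poly_times q" .
  fix y
  have "poly_eval ?r y = (\<Sum>\<alpha>\<in>Poly_Mapping.keys p. \<Sum>\<beta>\<in>Poly_Mapping.keys q.
      Poly_Mapping.lookup p \<alpha> * Poly_Mapping.lookup q \<beta> * (mono_eval \<alpha> y * mono_eval \<beta> y))"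
    by (simp only: poly_eval_sum poly_eval_single mono_eval_add)
  also have "\<dots> = (\<Sum>\<alpha>\<in>Poly_Mapping.keys p. Poly_Mapping.lookup p \<alpha> * mono_eval \<alpha> y) *
      (\<Sum>\<beta>\<in>Poly_Mapping.keys q. Poly_Mapping.lookup q \<beta> * mono_eval \<beta> y)"
    unfolding sum_product by (intro sum.cong refl) (simp only: mult_ac)
  also have "\<dots> = poly_eval p y * poly_eval q y"
    by (simp only: poly_eval_superset[OF finite_keys order_refl])
  finally show "poly_eval ?r y = poly_eval p y * poly_eval q y" .
qed

text \<open>Elements of \<open>rv_span\<close> are \<open>undefined\<close> off
  \<open>Omega\<close>, which pointwise sums and products need not preserve. Leaving the values off
  \<open>Omega\<close> free gives a set closed under them, as \<open>moment_algebra\<close>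
  requires.\<close>

definition bm_functions :: "real set \<Rightarrow> ((real \<Rightarrow> real) \<Rightarrow> real) set" where
  "bm_functions T = {h. restrict h Omega \<in> rv_span (bm_products T)}"

lemma bm_functions_iff:
  "h \<in> bm_functions T \<longleftrightarrow> (\<exists>p. poly_times p \<subseteq> T \<and> (\<forall>\<omega>\<in>Omega. h \<omega> = poly_eval p \<omega>))"
proof -
  have "restrict h Omega = bm_poly p \<longleftrightarrow> (\<forall>\<omega>\<in>Omega. h \<omega> = poly_eval p \<omega>)" for p
    by (auto simp: bm_poly_def restrict_def fun_eq_iff)
  then show ?thesis
    by (simp add: bm_functions_def rv_span_bm_products image_iff)
qed

lemma bm_functions_poly_eval: "poly_times p \<subseteq> T \<Longrightarrow> poly_eval p \<in> bm_functions T"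
  by (auto simp: bm_functions_iff)

lemma bm_functions_const: "(\<lambda>_. a) \<in> bm_functions T"
  unfolding bm_functions_iff
  by (intro exI[of _ "Poly_Mapping.single 0 a"])
     (auto simp: poly_eval_single mono_eval_def poly_times_def)

lemma bm_functions_coord: "t \<in> T \<Longrightarrow> (\<lambda>\<omega>. \<omega> t) \<in> bm_functions T"
  unfolding bm_functions_iff
  by (intro exI[of _ "Poly_Mapping.single (Poly_Mapping.single t 1) 1"])
     (auto simp: poly_eval_single mono_eval_def poly_times_def)

lemma bm_functions_add:
  assumes "h \<in> bm_functions T" "g \<in> bm_functions T"
  shows "(\<lambda>\<omega>. h \<omega> + g \<omega>) \<in> bm_functions T"
proof -
  obtain p q where "poly_times p \<subseteq> T" "\<forall>\<omega>\<in>Omega. h \<omega> = poly_eval p \<omega>"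
    "poly_times q \<subseteq> T" "\<forall>\<omega>\<in>Omega. g \<omega> = poly_eval q \<omega>"
    using assms by (auto simp: bm_functions_iff)
  then show ?thesis
    unfolding bm_functions_iff using poly_times_add[of p q]
    by (intro exI[of _ "p + q"]) (auto simp: poly_eval_add)
qed

lemma bm_functions_mult:
  assumes "h \<in> bm_functions T" "g \<in> bm_functions T"
  shows "(\<lambda>\<omega>. h \<omega> * g \<omega>) \<in> bm_functions T"
proof -
  obtain p q where "poly_times p \<subseteq> T" "\<forall>\<omega>\<in>Omega. h \<omega> = poly_eval p \<omega>"
    "poly_times q \<subseteq> T" "\<forall>\<omega>\<in>Omega. g \<omega> = poly_eval q \<omega>"
    using assms by (auto simp: bm_functions_iff)
  with poly_eval_mult_exists[of p q] show ?thesis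
    unfolding bm_functions_iff by (metis le_sup_iff order_trans)
qed

lemma bm_functions_mono: "S \<subseteq> T \<Longrightarrow> bm_functions S \<subseteq> bm_functions T"
  unfolding subset_iff[of "bm_functions S"] bm_functions_iff by (meson order_trans)

section \<open>Coordinates under Wiener measure\<close>

lemma space_coord_filtration [simp]: "space (coord_filtration t) = Omega"
  unfolding coord_filtration_def by (rule space_measure_of) auto

lemma sets_coord_filtration:
  "sets (coord_filtration t) =
     sigma_sets Omega {(\<lambda>\<omega>. \<omega> s) -` B \<inter> Omega | s B. s \<in> {0..t} \<and> B \<in> sets borel}"
  unfolding coord_filtration_def by (rule sets_measure_of) auto

lemma measurable_coord_filtration:
  "s \<in> {0..t} \<Longrightarrow> (\<lambda>\<omega>. \<omega> s) \<in> borel_measurable (coord_filtration t)"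
  by (rule measurableI) (auto simp: sets_coord_filtration)

locale wiener =
  fixes W :: "(real \<Rightarrow> real) measure"
  assumes wiener: "wiener_measure W"
begin

lemma sets_W: "sets W = sets (coord_filtration 1)"
  and bm_W: "brownian_motion W coord_filtration (\<lambda>t \<omega>. \<omega> t)"
  using wiener by (auto simp: wiener_measure_def)

lemma space_W [simp]: "space W = Omega"
  using sets_eq_imp_space_eq[OF sets_W] by simp

sublocale prob_space W
  using bm_W by (simp add: brownian_motion_def filtered_prob_space_def)

lemma prob_Omega [simp]: "prob Omega = 1"
  using prob_space by simp

lemma measurable_coord: "t \<in> {0..1} \<Longrightarrow> (\<lambda>\<omega>. \<omega> t) \<in> borel_measurable W"
  using measurable_coord_filtration[of t 1] measurable_cong_sets[OF sets_W refl] by blast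

lemma increment_distributed:
  "0 \<le> s \<Longrightarrow> s < t \<Longrightarrow> t \<le> 1 \<Longrightarrow>
     distributed W lborel (\<lambda>\<omega>. \<omega> t - \<omega> s) (normal_density 0 (sqrt (t - s)))"
  using bm_W by (simp add: brownian_motion_def)

lemma increment_indep:
  "0 \<le> s \<Longrightarrow> s < t \<Longrightarrow> t \<le> 1 \<Longrightarrow> indep_set (sets (coord_filtration s))
     (sets (vimage_algebra Omega (\<lambda>\<omega>. \<omega> t - \<omega> s) borel))"
  using bm_W by (simp add: brownian_motion_def)

lemma Omega_0: "\<omega> \<in> Omega \<Longrightarrow> \<omega> 0 = 0"
  and Omega_continuous: "\<omega> \<in> Omega \<Longrightarrow> continuous_on {0..1} \<omega>"
  by (auto simp: Omega_def)

text \<open>On \<open>Omega\<close> the coordinate is the increment from time 0, hence Gaussian; t >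
  0 keeps its variance positive.\<close>

lemma exp_abs_coord:
  assumes "t \<in> {0<..1}"
  shows "(\<lambda>\<omega>. exp \<bar>\<omega> t\<bar>) \<in> all_moments W"
proof -
  have "(\<lambda>\<omega>. exp \<bar>\<omega> t - \<omega> 0\<bar>) \<in> all_moments W"
    by (rule exp_abs_normal_all_moments[OF increment_distributed]) (use assms in auto)
  then show ?thesis
    by (subst (asm) all_moments_cong[of _ _ "\<lambda>\<omega>. exp \<bar>\<omega> t\<bar>"]) (auto simp: Omega_0)
qed

text \<open>Time 0 may lie outside \<open>T\<close>, but the coordinate there is the constant 0 on
  \<open>Omega\<close>. The first increment of each partition relies on this.\<close>

lemma bm_functions_coord_0: "(\<lambda>\<omega>. \<omega> 0) \<in> bm_functions T"
  using bm_functions_const[of 0 T] by (simp add: bm_functions_iff Omega_0)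

lemma coord_all_moments: "t \<in> {0<..1} \<Longrightarrow> (\<lambda>\<omega>. \<omega> t) \<in> all_moments W"
  by (rule all_moments_bound[OF exp_abs_coord]) (auto intro: measurable_coord abs_le_exp_abs)

lemma bm_functions_all_moments:
  assumes "T \<subseteq> {0<..1}"
  shows "bm_functions T \<subseteq> all_moments W"
proof
  have pow: "(\<lambda>x. f x ^ n) \<in> all_moments W" if "f \<in> all_moments W" for f n
    using that by (induction n) (auto intro: all_moments_const all_moments_mult)
  have prd: "(\<lambda>x. \<Prod>i\<in>I. f i x) \<in> all_moments W" if "\<And>i. i \<in> I \<Longrightarrow> f i \<in> all_moments W"
    for f :: "real \<Rightarrow> (real \<Rightarrow> real) \<Rightarrow> real" and I
    using that by (induction I rule: infinite_finite_induct) (auto intro: all_moments_const all_moments_mult)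
  have sm: "(\<lambda>x. \<Sum>i\<in>I. f i x) \<in> all_moments W" if "\<And>i. i \<in> I \<Longrightarrow> f i \<in> all_moments W"
    for f :: "(real \<Rightarrow>\<^sub>0 nat) \<Rightarrow> (real \<Rightarrow> real) \<Rightarrow> real" and I
    using that by (induction I rule: infinite_finite_induct) (auto intro: all_moments_const all_moments_add)
  fix h assume "h \<in> bm_functions T"
  then obtain p where p: "poly_times p \<subseteq> T" "\<And>\<omega>. \<omega> \<in> Omega \<Longrightarrow> h \<omega> = poly_eval p \<omega>"
    by (auto simp: bm_functions_iff)
  have "t \<in> {0<..1}" if "\<alpha> \<in> Poly_Mapping.keys p" "t \<in> Poly_Mapping.keys \<alpha>" for \<alpha> t
    using that p(1) assms unfolding poly_times_def by blast
  then have "poly_eval p \<in> all_moments W"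
    unfolding poly_eval_def[abs_def]
    by (intro sm prd pow all_moments_cmult coord_all_moments)
  then show "h \<in> all_moments W"
    by (subst all_moments_cong[of _ _ "poly_eval p"]) (simp_all add: p)
qed

lemma moment_algebra_bm_functions:
  "T \<subseteq> {0<..1} \<Longrightarrow> moment_algebra W (bm_functions T)"
  by unfold_locales
     (auto intro: bm_functions_const bm_functions_add bm_functions_mult
       dest!: bm_functions_all_moments)

text \<open>Approaching from below keeps the sequence inside the interval also for t = 1; the
  maximum with 0 keeps it positive.\<close>

lemma rational_sequence_below:
  assumes "t \<in> {0<..1::real}"
  obtains q where "\<And>n. q n \<in> \<rat> \<inter> {0<..1}" "q \<longlonglongrightarrow> t"
proof -
  have "\<exists>r. r \<in> \<rat> \<and> max 0 (t - inverse (real (Suc n))) < r \<and> r < t" for n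
    using Rats_dense_in_real[of "max 0 (t - inverse (real (Suc n)))" t] assms by auto
  then obtain q where q: "\<And>n. q n \<in> \<rat>" "\<And>n. max 0 (t - inverse (real (Suc n))) < q n" "\<And>n. q n < t"
    by metis
  have "(\<lambda>n. q n) \<longlonglongrightarrow> t"
  proof (rule tendsto_sandwich[OF _ _ _ tendsto_const])
    show "(\<lambda>n. t - inverse (real (Suc n))) \<longlonglongrightarrow> t"
      using tendsto_diff[OF tendsto_const LIMSEQ_inverse_real_of_nat, of t] by simp
  qed (use q in \<open>auto intro!: always_eventually less_imp_le simp del: of_nat_Suc\<close>)
  moreover have "q n \<in> \<rat> \<inter> {0<..1}" for n
    using q(1,2,3)[of n] assms by auto
  ultimately show thesis
    using that by blast
qed

text \<open>The dense times suffice to generate the whole \<open>\<sigma>\<close>-algebra because the paths are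
  continuous.\<close>

lemma dense_moment_algebra_rational:
  "dense_moment_algebra W (bm_functions (\<rat> \<inter> {0<..1}))"
proof -
  interpret moment_algebra W "bm_functions (\<rat> \<inter> {0<..1})"
    by (rule moment_algebra_bm_functions) auto
  have rat: "(\<lambda>\<omega>. \<omega> q) \<in> borel_measurable moment_closure_sets" if "q \<in> \<rat> \<inter> {0<..1}" for q
    using that by (intro measurable_moment_closure_sets bm_functions_coord exp_abs_coord) auto
  have coord: "(\<lambda>\<omega>. \<omega> t) \<in> borel_measurable moment_closure_sets" if "t \<in> {0..1}" for t
  \<comment> \<open>Time 0 occurs among the generators of \<open>coord_filtration 1\<close> but not
    among the times of the polynomials; its coordinate is constant on \<open>Omega\<close>.\<close>
  proof (cases "t = 0")
    case True
    have "(\<lambda>\<omega>. \<omega> t) \<in> borel_measurable moment_closure_sets \<longleftrightarrow> (\<lambda>_. 0 :: real) \<in> borel_measurable moment_closure_sets"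
      by (rule measurable_cong) (use True in \<open>auto simp: Omega_0\<close>)
    then show ?thesis by simp
  next
    case False
    with that have "t \<in> {0<..1}" by auto
    from rational_sequence_below[OF this] obtain q
      where q: "\<And>n. q n \<in> \<rat> \<inter> {0<..1}" "q \<longlonglongrightarrow> t" by blast
    show ?thesis
    proof (rule borel_measurable_LIMSEQ_real)
      show "(\<lambda>\<omega>. \<omega> (q n)) \<in> borel_measurable moment_closure_sets" for n
        by (rule rat[OF q(1)])
      show "(\<lambda>n. \<omega> (q n)) \<longlonglongrightarrow> \<omega> t" if "\<omega> \<in> space moment_closure_sets" for \<omega>
        by (rule continuous_on_tendsto_compose[OF Omega_continuous q(2)])
           (use that \<open>t \<in> {0..1}\<close> q(1) in \<open>auto intro!: always_eventually less_imp_le\<close>)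
    qed
  qed
  have "sets W \<subseteq> sets moment_closure_sets"
    unfolding sets_W sets_coord_filtration
  proof (rule sets.sigma_sets_subset[of _ moment_closure_sets, simplified space_moment_closure_sets space_W])
    show "{(\<lambda>\<omega>. \<omega> s) -` B \<inter> Omega |s B. s \<in> {0..1} \<and> B \<in> sets borel} \<subseteq> sets moment_closure_sets"
      using measurable_sets[OF coord] by fastforce
  qed
  then show ?thesis
    by unfold_locales (auto simp: sets_moment_closure_sets)
qed

section \<open>Quadratic variation\<close>

definition centred_square :: "nat \<Rightarrow> nat \<Rightarrow> (real \<Rightarrow> real) \<Rightarrow> real" where
  "centred_square n k \<omega> = (\<omega> (real (k + 1) / real n) - \<omega> (real k / real n))\<^sup>2 - 1 / real n"

text \<open>An increment over length 1/n has second moment 1/n, which is subtracted in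
  \<open>centred_square\<close>, and fourth moment 3/n^2; expanding the square gives 3/n^2 - 2/n^2 +
  1/n^2.\<close>

lemma centred_square_moments:
  assumes "k < n"
  shows "integrable W (centred_square n k)" "(\<integral>\<omega>. centred_square n k \<omega> \<partial>W) = 0"
    "integrable W (\<lambda>\<omega>. (centred_square n k \<omega>)\<^sup>2)"
    "(\<integral>\<omega>. (centred_square n k \<omega>)\<^sup>2 \<partial>W) = 2 / (real n)\<^sup>2"
proof -
  have n: "0 < real n" using assms by simp
  define \<sigma> where "\<sigma> = sqrt (1 / real n)"
  have \<sigma>: "0 < \<sigma>" "\<sigma>\<^sup>2 = 1 / real n"
    using n by (auto simp: \<sigma>_def)
  let ?X = "\<lambda>\<omega>::real\<Rightarrow>real. \<omega> (real (k + 1) / real n) - \<omega> (real k / real n)"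
  have "real (k + 1) / real n - real k / real n = 1 / real n"
    by (simp add: add_divide_distrib)
  then have D: "distributed W lborel ?X (normal_density 0 \<sigma>)"
    using increment_distributed[of "real k / real n" "real (k + 1) / real n"] assms
    by (simp add: \<sigma>_def divide_strict_right_mono)
  have i: "integrable W (\<lambda>\<omega>. ?X \<omega> ^ j)" for j
    using distributed_integrable[OF D, of "\<lambda>x. x ^ j"] integrable_normal_moment[OF \<sigma>(1), of 0 j] by simp
  have m: "(\<integral>\<omega>. ?X \<omega> ^ (2 * j) \<partial>W) = fact (2 * j) / ((2 / \<sigma>\<^sup>2) ^ j * fact j)" for j
    using distributed_integral[OF D, of "\<lambda>x. x ^ (2 * j)"] integral_normal_moment_even[OF \<sigma>(1), of 0 j] by simp
  have m2: "(\<integral>\<omega>. ?X \<omega> ^ 2 \<partial>W) = 1 / real n"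
    using m[of 1] n by (simp add: \<sigma>(2) fact_numeral)
  have m4: "(\<integral>\<omega>. ?X \<omega> ^ 4 \<partial>W) = 3 / (real n)\<^sup>2"
    using m[of 2] n unfolding \<sigma>(2) by (simp add: fact_numeral power2_eq_square)
  have sq: "(centred_square n k \<omega>)\<^sup>2 = ?X \<omega> ^ 4 - 2 / real n * ?X \<omega> ^ 2 + 1 / (real n)\<^sup>2" for \<omega>
  proof -
    have "(x\<^sup>2 - a)\<^sup>2 = x ^ 4 - 2 * a * x\<^sup>2 + a\<^sup>2" for x a :: real
      by (simp add: power2_diff power_mult[symmetric])
    from this[of "?X \<omega>" "1 / real n"] show ?thesis
      by (simp add: centred_square_def power_divide)
  qed
  show "integrable W (centred_square n k)" "(\<integral>\<omega>. centred_square n k \<omega> \<partial>W) = 0"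
    unfolding centred_square_def[abs_def] using i[of 2] m2 by (auto simp: prob_space)
  show "integrable W (\<lambda>\<omega>. (centred_square n k \<omega>)\<^sup>2)"
    unfolding sq by (intro Bochner_Integration.integrable_add Bochner_Integration.integrable_diff
        integrable_mult_right i integrable_const)
  have "(\<integral>\<omega>. (centred_square n k \<omega>)\<^sup>2 \<partial>W) = 3 / (real n)\<^sup>2 - 2 / real n * (1 / real n) + 1 / (real n)\<^sup>2"
    unfolding sq using i[of 4] i[of 2] m4 m2 by simp
  then show "(\<integral>\<omega>. (centred_square n k \<omega>)\<^sup>2 \<partial>W) = 2 / (real n)\<^sup>2"
    by (simp add: power2_eq_square)
qed

text \<open>For j < k the j-th interval ends no later than k/n, so its increment is measurable at
  time k/n and independent of the k-th one; the expectation then factors, and the j-th factor has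
  mean 0.\<close>

lemma centred_square_uncorrelated:
  assumes "j < k" "k < n"
  shows "integrable W (\<lambda>\<omega>. centred_square n j \<omega> * centred_square n k \<omega>)"
    "(\<integral>\<omega>. centred_square n j \<omega> * centred_square n k \<omega> \<partial>W) = 0"
proof -
  let ?G = "vimage_algebra Omega (\<lambda>\<omega>::real\<Rightarrow>real. \<omega> (real (k + 1) / real n) - \<omega> (real k / real n)) borel"
  have "indep_var borel (centred_square n j) borel (centred_square n k)"
  proof (rule indep_set_imp_indep_var)
    show "indep_set (sets (coord_filtration (real k / real n))) (sets ?G)"
      by (rule increment_indep) (use assms in \<open>auto simp: divide_simps\<close>)
    have [measurable]: "(\<lambda>\<omega>. \<omega> (real (j + 1) / real n)) \<in> borel_measurable (coord_filtration (real k / real n))"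
      "(\<lambda>\<omega>. \<omega> (real j / real n)) \<in> borel_measurable (coord_filtration (real k / real n))"
      using assms by (auto intro!: measurable_coord_filtration divide_right_mono)
    show "centred_square n j \<in> borel_measurable (coord_filtration (real k / real n))"
      unfolding centred_square_def[abs_def] by measurable
    have [measurable]: "(\<lambda>\<omega>. \<omega> (real (k + 1) / real n) - \<omega> (real k / real n)) \<in> borel_measurable ?G"
      by (rule measurable_vimage_algebra1) simp
    show "centred_square n k \<in> borel_measurable ?G"
      unfolding centred_square_def[abs_def] by measurable
  qed simp_all
  moreover have "integrable W (centred_square n j)" "integrable W (centred_square n k)"
    using centred_square_moments(1) assms by auto
  ultimately show "integrable W (\<lambda>\<omega>. centred_square n j \<omega> * centred_square n k \<omega>)"
      "(\<integral>\<omega>. centred_square n j \<omega> * centred_square n k \<omega> \<partial>W) = 0"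
    using centred_square_moments(2)[of j n] assms
    by (auto simp: indep_var_integrable indep_var_lebesgue_integral)
qed

lemma centred_square_prod:
  assumes "j < n" "k < n"
  shows "integrable W (\<lambda>\<omega>. centred_square n j \<omega> * centred_square n k \<omega>)"
    "(\<integral>\<omega>. centred_square n j \<omega> * centred_square n k \<omega> \<partial>W) = (if j = k then 2 / (real n)\<^sup>2 else 0)"
  using centred_square_uncorrelated[of j k n] centred_square_uncorrelated[of k j n]
    centred_square_moments(3,4)[of k n] assms
  by (cases j k rule: linorder_cases; simp add: mult.commute power2_eq_square)+

text \<open>In the expanded square only the n diagonal terms survive, each equal to 2/n^2.\<close>

lemma quadratic_variation_L2:
  assumes "0 < n"
  shows "integrable W (\<lambda>\<omega>. (\<Sum>k<n. centred_square n k \<omega>)\<^sup>2)"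
    "(\<integral>\<omega>. (\<Sum>k<n. centred_square n k \<omega>)\<^sup>2 \<partial>W) = 2 / real n"
proof -
  have eq: "(\<Sum>k<n. centred_square n k \<omega>)\<^sup>2 =
      (\<Sum>j<n. \<Sum>k<n. centred_square n j \<omega> * centred_square n k \<omega>)" for \<omega>
    by (simp add: power2_eq_square sum_product)
  show "integrable W (\<lambda>\<omega>. (\<Sum>k<n. centred_square n k \<omega>)\<^sup>2)"
    unfolding eq by (intro Bochner_Integration.integrable_sum centred_square_prod) auto
  have "(\<integral>\<omega>. (\<Sum>k<n. centred_square n k \<omega>)\<^sup>2 \<partial>W) =
      (\<Sum>j<n. \<integral>\<omega>. (\<Sum>k<n. centred_square n j \<omega> * centred_square n k \<omega>) \<partial>W)"
    unfolding eq
    by (intro Bochner_Integration.integral_sum Bochner_Integration.integrable_sum centred_square_prod) auto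
  also have "\<dots> = (\<Sum>j<n. \<Sum>k<n. \<integral>\<omega>. centred_square n j \<omega> * centred_square n k \<omega> \<partial>W)"
    by (intro sum.cong refl Bochner_Integration.integral_sum centred_square_prod) auto
  also have "\<dots> = (\<Sum>j<n. \<Sum>k<n. if j = k then 2 / (real n)\<^sup>2 else 0)"
    by (intro sum.cong refl centred_square_prod) auto
  also have "\<dots> = 2 / real n"
    using assms by (simp add: sum.delta power2_eq_square)
  finally show "(\<integral>\<omega>. (\<Sum>k<n. centred_square n k \<omega>)\<^sup>2 \<partial>W) = 2 / real n" .
qed

text \<open>Cauchy-Schwarz against the constant 1 turns the L^2 value into the bound sqrt (2/n). The
  L^1 form is the one that the functional can see.\<close>

lemma quadratic_variation_L1:
  "(\<lambda>n. \<integral>\<omega>. \<bar>\<Sum>k<n. centred_square n k \<omega>\<bar> \<partial>W) \<longlonglongrightarrow> 0"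
proof (rule tendsto_sandwich[OF _ _ tendsto_const])
  show "\<forall>\<^sub>F n in sequentially. 0 \<le> (\<integral>\<omega>. \<bar>\<Sum>k<n. centred_square n k \<omega>\<bar> \<partial>W)"
    by simp
  have "(\<integral>\<omega>. \<bar>\<Sum>k<n. centred_square n k \<omega>\<bar> \<partial>W) \<le> sqrt (2 / real n)" if "0 < n" for n
  proof -
    have "(\<lambda>\<omega>. \<Sum>k<n. centred_square n k \<omega>) \<in> borel_measurable W"
      by (intro borel_measurable_sum borel_measurable_integrable centred_square_moments) auto
    from Cauchy_Schwarz_integral(2)[OF this, of "\<lambda>_. 1"] quadratic_variation_L2[OF that]
    show ?thesis by simp
  qed
  then show "\<forall>\<^sub>F n in sequentially. (\<integral>\<omega>. \<bar>\<Sum>k<n. centred_square n k \<omega>\<bar> \<partial>W) \<le> sqrt (2 / real n)"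
    by (rule eventually_mono[OF eventually_gt_at_top[of 0]])
  show "(\<lambda>n. sqrt (2 / real n)) \<longlonglongrightarrow> 0"
    using tendsto_real_sqrt[OF lim_const_over_n[of 2]] by simp
qed

lemma rational_centred_square:
  assumes "k < n"
  shows "centred_square n k \<in> bm_functions (\<rat> \<inter> {0<..1})"
    and "(\<lambda>\<omega>. (\<omega> (real (k + 1) / real n) - \<omega> (real k / real n))\<^sup>2) \<in> bm_functions (\<rat> \<inter> {0<..1})"
proof -
  interpret moment_algebra W "bm_functions (\<rat> \<inter> {0<..1})"
    by (rule moment_algebra_bm_functions) auto
  have 1: "(\<lambda>\<omega>. \<omega> (real (k + 1) / real n)) \<in> bm_functions (\<rat> \<inter> {0<..1})"
    using assms by (intro bm_functions_coord) auto
  \<comment> \<open>For k = 0 the left endpoint is time 0, which is not an admissible time.\<close>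
  have 2: "(\<lambda>\<omega>. \<omega> (real k / real n)) \<in> bm_functions (\<rat> \<inter> {0<..1})"
    by (cases "k = 0") (use assms in \<open>auto intro!: bm_functions_coord simp: bm_functions_coord_0\<close>)
  have "(\<lambda>\<omega>. \<omega> (real (k + 1) / real n) + - 1 * \<omega> (real k / real n)) \<in> bm_functions (\<rat> \<inter> {0<..1})"
    by (intro P_add P_cmult 1 2)
  from P_power[OF this, of 2]
  show 3: "(\<lambda>\<omega>. (\<omega> (real (k + 1) / real n) - \<omega> (real k / real n))\<^sup>2) \<in> bm_functions (\<rat> \<inter> {0<..1})"
    by simp
  from P_add[OF this P_const[of "- (1 / real n)"]]
  show "centred_square n k \<in> bm_functions (\<rat> \<inter> {0<..1})"
    by (simp add: centred_square_def[abs_def])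
qed

end

subsection \<open>The representation theorem\<close>

lemma rv_span_extensional: "h \<in> rv_span V \<Longrightarrow> restrict h Omega = h"
  by (auto simp: rv_span_def)

lemma rv_span_in_bm_functions: "h \<in> rv_span (bm_products T) \<Longrightarrow> h \<in> bm_functions T"
  by (simp add: bm_functions_def rv_span_extensional)

text \<open>Restricting every argument to \<open>Omega\<close> transfers linearity from the span to
  functions with arbitrary values off \<open>Omega\<close>.\<close>

lemma linear_functional_bm_functions:
  assumes "linear_functional_on (rv_span (bm_products T)) L"
  shows "h \<in> bm_functions T \<Longrightarrow> g \<in> bm_functions T \<Longrightarrow>
      L (\<lambda>\<omega>\<in>Omega. h \<omega> + g \<omega>) = L (restrict h Omega) + L (restrict g Omega)"
    and "h \<in> bm_functions T \<Longrightarrow> L (\<lambda>\<omega>\<in>Omega. a * h \<omega>) = a * L (restrict h Omega)"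
proof -
  assume h: "h \<in> bm_functions T"
  have eq: "(\<lambda>\<omega>\<in>Omega. a * h \<omega>) = (\<lambda>\<omega>\<in>Omega. a * restrict h Omega \<omega>)"
    by (rule restrict_ext) simp
  show "L (\<lambda>\<omega>\<in>Omega. a * h \<omega>) = a * L (restrict h Omega)"
    using assms h unfolding eq linear_functional_on_def bm_functions_def by blast
  assume g: "g \<in> bm_functions T"
  have eq: "(\<lambda>\<omega>\<in>Omega. h \<omega> + g \<omega>) = (\<lambda>\<omega>\<in>Omega. restrict h Omega \<omega> + restrict g Omega \<omega>)"
    by (rule restrict_ext) simp
  show "L (\<lambda>\<omega>\<in>Omega. h \<omega> + g \<omega>) = L (restrict h Omega) + L (restrict g Omega)"
    using assms h g unfolding eq linear_functional_on_def bm_functions_def by blast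
qed

text \<open>Continuity at 0 with tolerance 1 gives a radius d, and scaling h into the ball yields
  the constant 2 / d. Functions of norm 0 need a separate argument.\<close>

lemma (in wiener) L1_continuous_imp_bounded:
  assumes T: "T \<subseteq> {0<..1}"
    and lin: "linear_functional_on (rv_span (bm_products T)) L"
    and cont: "L1_continuous_on W (rv_span (bm_products T)) L"
  shows "\<exists>C\<ge>0. \<forall>h\<in>bm_functions T. \<bar>L (restrict h Omega)\<bar> \<le> C * (\<integral>\<omega>. \<bar>h \<omega>\<bar> \<partial>W)"
proof -
  interpret moment_algebra W "bm_functions T"
    by (rule moment_algebra_bm_functions[OF T])
  note L_lin = linear_functional_bm_functions[OF lin]
  have zero: "L (\<lambda>\<omega>\<in>Omega. 0) = 0"
    using L_lin(2)[OF P_const, of 0 0] by simp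
  have "(\<lambda>\<omega>\<in>Omega. 0) \<in> rv_span (bm_products T)"
    using P_const[of 0] by (simp add: bm_functions_def)
  then obtain d where d: "0 < d" "\<And>g. g \<in> rv_span (bm_products T) \<Longrightarrow>
      (\<integral>\<omega>. \<bar>g \<omega> - (\<lambda>\<omega>\<in>Omega. 0) \<omega>\<bar> \<partial>W) < d \<Longrightarrow> \<bar>L g - L (\<lambda>\<omega>\<in>Omega. 0)\<bar> < 1"
    using cont unfolding L1_continuous_on_def by (meson zero_less_one)
  have small: "\<bar>a\<bar> * \<bar>L (restrict h Omega)\<bar> < 1"
    if h: "h \<in> bm_functions T" and "\<bar>a\<bar> * (\<integral>\<omega>. \<bar>h \<omega>\<bar> \<partial>W) < d" for h a
  proof -
    have "(\<integral>\<omega>. \<bar>(\<lambda>\<omega>\<in>Omega. a * h \<omega>) \<omega> - (\<lambda>\<omega>\<in>Omega. 0) \<omega>\<bar> \<partial>W) = (\<integral>\<omega>. \<bar>a\<bar> * \<bar>h \<omega>\<bar> \<partial>W)"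
      by (rule Bochner_Integration.integral_cong) (auto simp: abs_mult)
    moreover have "(\<lambda>\<omega>\<in>Omega. a * h \<omega>) \<in> rv_span (bm_products T)"
      using P_cmult[OF h, of a] by (simp add: bm_functions_def)
    ultimately have "\<bar>L (\<lambda>\<omega>\<in>Omega. a * h \<omega>)\<bar> < 1"
      using d(2) that(2) by (simp add: zero)
    then show ?thesis
      by (simp add: L_lin(2)[OF h] abs_mult)
  qed
  have "\<bar>L (restrict h Omega)\<bar> \<le> 2 / d * (\<integral>\<omega>. \<bar>h \<omega>\<bar> \<partial>W)" if h: "h \<in> bm_functions T" for h
  proof -
    let ?N = "\<integral>\<omega>. \<bar>h \<omega>\<bar> \<partial>W"
    have "0 \<le> ?N" by simp
    then consider "?N = 0" | "0 < ?N" by linarith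
    then show ?thesis
    proof cases
      case 1
      have "L (restrict h Omega) = 0"
      proof (rule ccontr)
        \<comment> \<open>Scaling by the inverse of the value keeps the norm at 0 but makes the
          value 1, which should be less than 1.\<close>
        assume "L (restrict h Omega) \<noteq> 0"
        with small[OF h, of "1 / L (restrict h Omega)"] 1 d(1) show False
          by simp
      qed
      with 1 show ?thesis by simp
    next
      case 2
      \<comment> \<open>The factor brings the norm of h to d / 2, strictly inside the ball.\<close>
      have "\<bar>d / (2 * ?N)\<bar> * \<bar>L (restrict h Omega)\<bar> < 1"
        by (rule small[OF h]) (use 2 d(1) in \<open>simp add: abs_mult\<close>)
      then show ?thesis
        using 2 d(1) by (simp add: abs_mult field_simps)
    qed
  qed
  with d(1) show ?thesis
    by (intro exI[of _ "2 / d"]) auto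
qed

theorem theorem1:
  fixes W :: "(real \<Rightarrow> real) measure"
    and L :: "((real \<Rightarrow> real) \<Rightarrow> real) \<Rightarrow> real"
    and c :: real
    and m :: nat
    and f :: "nat \<Rightarrow> time_poly"
  assumes W: "wiener_measure W"
    and L_linear: "linear_functional_on rational_bm_polys L"
    and L_continuous: "L1_continuous_on W rational_bm_polys L"
    and L_one: "L (\<lambda>\<omega>\<in>Omega. 1) = 1"
    and c_pos: "c > 0"
    and quadratic_variation: "\<And>g. g \<in> rational_bm_polys \<Longrightarrow>
      (\<lambda>n::nat. real n * Max ((\<lambda>k::nat.
         \<bar>L (\<lambda>\<omega>\<in>Omega. (g \<omega>)\<^sup>2 * \<bar>\<omega> (real (k + 1) / real n) - \<omega> (real k / real n)\<bar>\<^sup>2)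
          - c / real n * L (\<lambda>\<omega>\<in>Omega. (g \<omega>)\<^sup>2)\<bar>) ` {0..<n})) \<longlonglongrightarrow> 0"
    and f_times: "\<And>i. i \<in> {1..m} \<Longrightarrow> poly_times (f i) \<subseteq> \<rat> \<inter> {0<..1}"
    and f_nonneg: "\<And>(k::nat \<Rightarrow> nat) g. \<lbrakk>k \<in> {1..m} \<rightarrow>\<^sub>E {0, 1}; g \<in> rational_bm_polys\<rbrakk> \<Longrightarrow>
      L (\<lambda>\<omega>\<in>Omega. (g \<omega>)\<^sup>2 * (\<Prod>i=1..m. bm_poly (f i) \<omega> ^ k i)) \<ge> 0"
  shows "(\<exists>(\<gamma> :: (real \<Rightarrow> real) measure) (G :: real \<Rightarrow> (real \<Rightarrow> real) measure)
            (B :: real \<Rightarrow> (real \<Rightarrow> real) \<Rightarrow> real).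
            filtered_prob_space \<gamma> G \<and>
            (\<forall>x\<in>space \<gamma>. continuous_on {0..1} (\<lambda>t. B t x)) \<and>
            (\<exists>\<eta>. sets \<eta> = sets \<gamma> \<and> brownian_motion \<eta> G B) \<and>
            (\<forall>i\<in>{1..m}. AE x in \<gamma>. poly_eval (f i) (\<lambda>t. c * B t x) \<ge> 0) \<and>
            (\<forall>p. poly_times p \<subseteq> \<rat> \<inter> {0<..1} \<longrightarrow>
               integrable \<gamma> (\<lambda>x. poly_eval p (\<lambda>t. c * B t x)) \<and>
               L (bm_poly p) = (\<integral>x. poly_eval p (\<lambda>t. c * B t x) \<partial>\<gamma>)))
       \<and> (\<exists>!L'. L' \<in> extensional real_bm_polys \<and>
            linear_functional_on real_bm_polys L' \<and>
            L1_continuous_on W real_bm_polys L' \<and>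
            (\<forall>h\<in>rational_bm_polys. L' h = L h))"
proof -
  let ?P = "bm_functions (\<rat> \<inter> {0<..1})"
  define l where "l = (\<lambda>h. L (restrict h Omega))"
  interpret wiener W
    by unfold_locales (rule W)
  interpret dense_moment_algebra W ?P
    by (rule dense_moment_algebra_rational)
  note L_lin = linear_functional_bm_functions[OF L_linear[unfolded rational_bm_polys_def]]
  have "\<exists>C\<ge>0. \<forall>h\<in>?P. \<bar>l h\<bar> \<le> C * (\<integral>\<omega>. \<bar>h \<omega>\<bar> \<partial>W)"
    unfolding l_def
    by (rule L1_continuous_imp_bounded[OF inf_le2 L_linear[unfolded rational_bm_polys_def]
        L_continuous[unfolded rational_bm_polys_def]])
  then obtain C where C: "0 \<le> C" "\<And>h. h \<in> ?P \<Longrightarrow> \<bar>l h\<bar> \<le> C * (\<integral>\<omega>. \<bar>h \<omega>\<bar> \<partial>W)"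
    by blast
  have P_iff: "h \<in> ?P \<longleftrightarrow> restrict h Omega \<in> rational_bm_polys" for h
    by (simp add: bm_functions_def rational_bm_polys_def)
  have square: "0 \<le> l (\<lambda>\<omega>. p \<omega> * p \<omega>)" if "p \<in> ?P" for p
  proof -
    \<comment> \<open>All exponents 0: the sign condition reduces to positivity on squares.\<close>
    have "0 \<le> L (\<lambda>\<omega>\<in>Omega. (restrict p Omega \<omega>)\<^sup>2 * (\<Prod>i=1..m. bm_poly (f i) \<omega> ^ (\<lambda>i\<in>{1..m}. 0) i))"
      by (rule f_nonneg[OF _ that[unfolded P_iff]]) (simp add: PiE_iff extensional_def)
    also have "(\<lambda>\<omega>\<in>Omega. (restrict p Omega \<omega>)\<^sup>2 * (\<Prod>i=1..m. bm_poly (f i) \<omega> ^ (\<lambda>i\<in>{1..m}. 0) i)) =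
        (\<lambda>\<omega>\<in>Omega. p \<omega> * p \<omega>)"
      by (rule restrict_ext) (simp add: power2_eq_square)
    finally show ?thesis unfolding l_def .
  qed
  have f_square: "0 \<le> l (\<lambda>\<omega>. p \<omega> * p \<omega> * poly_eval (f i) \<omega>)" if "p \<in> ?P" "i \<in> {1..m}" for p i
  proof -
    \<comment> \<open>The exponent vector with a single 1 isolates the factor
      \<open>f i\<close>.\<close>
    let ?k = "\<lambda>j\<in>{1..m}. if j = i then 1 else 0 :: nat"
    have "0 \<le> L (\<lambda>\<omega>\<in>Omega. (restrict p Omega \<omega>)\<^sup>2 * (\<Prod>j=1..m. bm_poly (f j) \<omega> ^ ?k j))"
      by (rule f_nonneg[OF _ that(1)[unfolded P_iff]]) (simp add: PiE_iff extensional_def)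
    also have "(\<lambda>\<omega>\<in>Omega. (restrict p Omega \<omega>)\<^sup>2 * (\<Prod>j=1..m. bm_poly (f j) \<omega> ^ ?k j)) =
        (\<lambda>\<omega>\<in>Omega. p \<omega> * p \<omega> * poly_eval (f i) \<omega>)"
    proof (rule restrict_ext)
      fix \<omega> assume "\<omega> \<in> Omega"
      have "(\<Prod>j=1..m. bm_poly (f j) \<omega> ^ ?k j) = (\<Prod>j=1..m. if j = i then bm_poly (f i) \<omega> else 1)"
        by (rule prod.cong) auto
      also have "\<dots> = bm_poly (f i) \<omega>"
        using that(2) by (simp add: prod.delta)
      finally show "(restrict p Omega \<omega>)\<^sup>2 * (\<Prod>j=1..m. bm_poly (f j) \<omega> ^ ?k j) =
          p \<omega> * p \<omega> * poly_eval (f i) \<omega>"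
        using \<open>\<omega> \<in> Omega\<close> by (simp add: power2_eq_square bm_poly_def)
    qed
    finally show ?thesis unfolding l_def .
  qed
  interpret positive_L1_functional W ?P l C
  proof
    show "p \<in> ?P \<Longrightarrow> q \<in> ?P \<Longrightarrow> l (\<lambda>\<omega>. p \<omega> + q \<omega>) = l p + l q" for p q
      unfolding l_def by (rule L_lin)
    show "p \<in> ?P \<Longrightarrow> l (\<lambda>\<omega>. a * p \<omega>) = a * l p" for p a
      unfolding l_def by (rule L_lin)
    show "p \<in> ?P \<Longrightarrow> \<bar>l p\<bar> \<le> C * (\<integral>\<omega>. \<bar>p \<omega>\<bar> \<partial>W)" for p
      by (rule C)
    show "0 \<le> C"
      by (rule C)
    show "p \<in> ?P \<Longrightarrow> 0 \<le> l (\<lambda>\<omega>. p \<omega> * p \<omega>)" for p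
      by (rule square)
  qed
  have one: "l (\<lambda>_. 1) = 1"
    unfolding l_def by (rule L_one)

  have "c = 1"
  proof -
    define D :: "nat \<Rightarrow> nat \<Rightarrow> (real \<Rightarrow> real) \<Rightarrow> real"
      where "D n k = (\<lambda>\<omega>. (\<omega> (real (k + 1) / real n) - \<omega> (real k / real n))\<^sup>2)" for n k
    \<comment> \<open>For n > 0, \<open>S n\<close> is the functional of the quadratic variation
      minus 1, and \<open>Q n\<close> is the hypothesis at g = 1. One measures the distance to 1,
      the other bounds the distance to c.\<close>
    define S where "S n = l (\<lambda>\<omega>. \<Sum>k<n. centred_square n k \<omega>)" for n
    define Q where "Q n = real n * Max ((\<lambda>k. \<bar>l (D n k) - c / real n\<bar>) ` {0..<n})" for n
    have Q: "Q \<longlonglongrightarrow> 0"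
    proof -
      have "L (\<lambda>\<omega>\<in>Omega. ((\<lambda>\<omega>\<in>Omega. 1 :: real) \<omega>)\<^sup>2 * \<bar>\<omega> (real (k + 1) / real n) - \<omega> (real k / real n)\<bar>\<^sup>2)
          = l (D n k)" for n k
        unfolding l_def D_def by (intro arg_cong[of _ _ L] restrict_ext) simp
      moreover have "L (\<lambda>\<omega>\<in>Omega. ((\<lambda>\<omega>\<in>Omega. 1 :: real) \<omega>)\<^sup>2) = 1"
        using L_one by (simp cong: restrict_cong)
      moreover have "(\<lambda>\<omega>\<in>Omega. 1) \<in> rational_bm_polys"
        using P_const[of 1] by (simp add: P_iff)
      ultimately show ?thesis
        unfolding Q_def[abs_def] using quadratic_variation[of "\<lambda>\<omega>\<in>Omega. 1"] by simp
    qed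
    have "S \<longlonglongrightarrow> 0"
    proof (rule Lim_null_comparison)
      show "\<forall>\<^sub>F n in sequentially. norm (S n) \<le> C * (\<integral>\<omega>. \<bar>\<Sum>k<n. centred_square n k \<omega>\<bar> \<partial>W)"
        unfolding S_def by (auto intro!: always_eventually C P_sum rational_centred_square)
      show "(\<lambda>n. C * (\<integral>\<omega>. \<bar>\<Sum>k<n. centred_square n k \<omega>\<bar> \<partial>W)) \<longlonglongrightarrow> 0"
        using tendsto_mult_left[OF quadratic_variation_L1, of C] by simp
    qed
    from tendsto_add[OF tendsto_rabs_zero[OF this] Q]
    have lim: "(\<lambda>n. \<bar>S n\<bar> + Q n) \<longlonglongrightarrow> 0" by simp
    have "\<bar>1 - c\<bar> \<le> \<bar>S n\<bar> + Q n" if "0 < n" for n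
    proof -
      have "l (centred_square n k) = l (D n k) - 1 / real n" if "k < n" for k
      proof -
        have "D n k \<in> ?P"
          unfolding D_def by (rule rational_centred_square[OF that])
        from l_add[OF this P_const, of "- (1 / real n)"] l_cmult[OF P_const, of "- (1 / real n)" 1] one
        show ?thesis by (simp add: centred_square_def[abs_def] D_def)
      qed
      then have "S n = (\<Sum>k<n. l (D n k) - 1 / real n)"
        unfolding S_def by (subst l_sum) (auto intro: rational_centred_square)
      also have "\<dots> = (\<Sum>k<n. l (D n k)) - 1"
        using that by (simp add: sum_subtractf)
      finally have S: "S n = (\<Sum>k<n. l (D n k)) - 1" .
      have "\<bar>(\<Sum>k<n. l (D n k)) - c\<bar> = \<bar>\<Sum>k<n. l (D n k) - c / real n\<bar>"
        using that by (simp add: sum_subtractf)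
      also have "\<dots> \<le> (\<Sum>k<n. \<bar>l (D n k) - c / real n\<bar>)"
        by (rule sum_abs)
      \<comment> \<open>Each error is at most the maximum; the n copies are absorbed by the factor n
        in \<open>Q n\<close>.\<close>
      also have "\<dots> \<le> (\<Sum>k<n. Max ((\<lambda>k. \<bar>l (D n k) - c / real n\<bar>) ` {0..<n}))"
        by (rule sum_mono, rule Max_ge) auto
      also have "\<dots> = Q n"
        by (simp add: Q_def)
      finally show ?thesis
        using S by linarith
    qed
    then have "\<bar>1 - c\<bar> \<le> 0"
      by (intro LIMSEQ_le_const[OF lim] exI[of _ 1]) auto
    then show ?thesis by simp
  qed

  \<comment> \<open>Stated without the factor c, which the last step of the proof removes by c =
    1.\<close>
  have part1: "filtered_prob_space representing_measure coord_filtration \<and>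
      (\<forall>x\<in>space representing_measure. continuous_on {0..1} x) \<and>
      (\<exists>\<eta>. sets \<eta> = sets representing_measure \<and> brownian_motion \<eta> coord_filtration (\<lambda>t \<omega>. \<omega> t)) \<and>
      (\<forall>i\<in>{1..m}. AE x in representing_measure. poly_eval (f i) x \<ge> 0) \<and>
      (\<forall>p. poly_times p \<subseteq> \<rat> \<inter> {0<..1} \<longrightarrow>
         integrable representing_measure (poly_eval p) \<and> L (bm_poly p) = (\<integral>x. poly_eval p x \<partial>representing_measure))"
  proof (intro conjI ballI allI impI)
    show "filtered_prob_space representing_measure coord_filtration"
      using bm_W prob_space_representing_measure[OF one]
      by (auto simp: brownian_motion_def filtered_prob_space_def subalgebra_def)
    show "continuous_on {0..1} x" if "x \<in> space representing_measure" for x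
      using that by (simp add: Omega_continuous)
    show "\<exists>\<eta>. sets \<eta> = sets representing_measure \<and> brownian_motion \<eta> coord_filtration (\<lambda>t \<omega>. \<omega> t)"
      using bm_W by (intro exI[of _ W]) simp
    show "AE x in representing_measure. poly_eval (f i) x \<ge> 0" if "i \<in> {1..m}" for i
      by (rule AE_representing_measure_nonneg[OF bm_functions_poly_eval[OF f_times[OF that]] f_square[OF _ that]])
    fix p assume "poly_times p \<subseteq> \<rat> \<inter> {0<..1}"
    then have p: "poly_eval p \<in> ?P"
      by (rule bm_functions_poly_eval)
    show "integrable representing_measure (poly_eval p)"
      by (rule integrable_representing_measure[OF P_integrable[OF p]])
    have "L (bm_poly p) = l (poly_eval p)"
      by (simp add: l_def bm_poly_def)
    also have "\<dots> = (\<integral>x. poly_eval p x \<partial>representing_measure)"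
      by (simp add: integral_representing_measure P_integrable p L1_extension_eq)
    finally show "L (bm_poly p) = (\<integral>x. poly_eval p x \<partial>representing_measure)" .
  qed

  define L' where "L' = (\<lambda>h\<in>real_bm_polys. \<integral>\<omega>. h \<omega> \<partial>representing_measure)"
  \<comment> \<open>Real times contribute only the algebra and its integrability.
    \<open>L1_extension\<close> remains the one built from rational times and is already defined on
    these polynomials.\<close>
  interpret R: moment_algebra W "bm_functions {0<..1}"
    by (rule moment_algebra_bm_functions) simp
  have real_bm: "h \<in> bm_functions {0<..1}" if "h \<in> real_bm_polys" for h
    using that unfolding real_bm_polys_def by (rule rv_span_in_bm_functions)
  have real_int: "integrable W h" if "h \<in> real_bm_polys" for h
    using real_bm[OF that] R.P_moments all_moments_integrable by blast
  have L'_L1_extension: "L' h = L1_extension h" if "h \<in> real_bm_polys" for h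
    using that by (simp add: L'_def integral_representing_measure real_int)
  have sub: "rational_bm_polys \<subseteq> real_bm_polys"
  proof
    fix h assume h: "h \<in> rational_bm_polys"
    then have "h \<in> ?P"
      unfolding rational_bm_polys_def by (rule rv_span_in_bm_functions)
    then have "restrict h Omega \<in> real_bm_polys"
      using bm_functions_mono[of "\<rat> \<inter> {0<..1}" "{0<..1}"]
      by (auto simp: bm_functions_def real_bm_polys_def)
    then show "h \<in> real_bm_polys"
      using h by (simp add: rational_bm_polys_def rv_span_extensional)
  qed
  have L'_L: "L' h = L h" if "h \<in> rational_bm_polys" for h
  proof -
    have P: "h \<in> ?P" and restr: "restrict h Omega = h"
      using that by (simp_all add: rational_bm_polys_def rv_span_in_bm_functions rv_span_extensional)
    have "L' h = l h"
      using L'_L1_extension L1_extension_eq[OF P] that sub by auto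
    then show ?thesis
      unfolding l_def restr .
  qed
  have part2: "\<exists>!L'. L' \<in> extensional real_bm_polys \<and> linear_functional_on real_bm_polys L' \<and>
      L1_continuous_on W real_bm_polys L' \<and> (\<forall>h\<in>rational_bm_polys. L' h = L h)"
  proof (rule ex1I[of _ L'], intro conjI ballI)
    show "L' \<in> extensional real_bm_polys"
      by (simp add: L'_def)
    show "linear_functional_on real_bm_polys L'"
      unfolding linear_functional_on_def
    proof (intro conjI ballI allI)
      fix h g assume hg: "h \<in> real_bm_polys" "g \<in> real_bm_polys"
      then have "(\<lambda>\<omega>\<in>Omega. h \<omega> + g \<omega>) \<in> real_bm_polys"
        using R.P_add[OF real_bm real_bm] by (simp add: bm_functions_def real_bm_polys_def)
      then have "L' (\<lambda>\<omega>\<in>Omega. h \<omega> + g \<omega>) = (\<integral>\<omega>. h \<omega> + g \<omega> \<partial>representing_measure)"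
        by (auto simp: L'_def intro!: Bochner_Integration.integral_cong)
      also have "\<dots> = L' h + L' g"
        using hg by (simp add: L'_def integrable_representing_measure real_int)
      finally show "L' (\<lambda>\<omega>\<in>Omega. h \<omega> + g \<omega>) = L' h + L' g" .
    next
      fix a h assume h: "h \<in> real_bm_polys"
      then have "(\<lambda>\<omega>\<in>Omega. a * h \<omega>) \<in> real_bm_polys"
        using R.P_cmult[OF real_bm] by (simp add: bm_functions_def real_bm_polys_def)
      then have "L' (\<lambda>\<omega>\<in>Omega. a * h \<omega>) = integral\<^sup>L representing_measure (\<lambda>\<omega>\<in>Omega. a * h \<omega>)"
        by (simp add: L'_def)
      also have "\<dots> = (\<integral>\<omega>. a * h \<omega> \<partial>representing_measure)"
        by (rule Bochner_Integration.integral_cong) auto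
      also have "\<dots> = a * L' h"
        using h by (simp add: L'_def)
      finally show "L' (\<lambda>\<omega>\<in>Omega. a * h \<omega>) = a * L' h" .
    qed
    show "L1_continuous_on W real_bm_polys L'"
      unfolding L1_continuous_on_def
    proof (intro ballI allI impI)
      fix h and e :: real assume h: "h \<in> real_bm_polys" and e: "0 < e"
      \<comment> \<open>The radius e / (C + 1) also covers C = 0 and makes the final inequality
        strict.\<close>
      have "\<bar>L' g - L' h\<bar> < e"
        if g: "g \<in> real_bm_polys" "(\<integral>\<omega>. \<bar>g \<omega> - h \<omega>\<bar> \<partial>W) < e / (C + 1)" for g
      proof -
        have "\<bar>L' g - L' h\<bar> \<le> C * (\<integral>\<omega>. \<bar>g \<omega> - h \<omega>\<bar> \<partial>W)"
          using h g by (simp add: L'_L1_extension L1_extension_diff_bound real_int)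
        also have "\<dots> \<le> C * (e / (C + 1))"
          using C(1) g(2) by (intro mult_left_mono) auto
        also have "\<dots> < e"
          using C(1) e by (simp add: field_simps)
        finally show ?thesis .
      qed
      then show "\<exists>d>0. \<forall>g\<in>real_bm_polys. (\<integral>\<omega>. \<bar>g \<omega> - h \<omega>\<bar> \<partial>W) < d \<longrightarrow> \<bar>L' g - L' h\<bar> < e"
        using C(1) e by (intro exI[of _ "e / (C + 1)"]) auto
    qed
    show "\<And>h. h \<in> rational_bm_polys \<Longrightarrow> L' h = L h"
      by (rule L'_L)
  next
    \<comment> \<open>Rational polynomials approximate h in L^1, so continuity forces the value of K
      at h. Off \<open>real_bm_polys\<close> only \<open>extensional\<close> determines K.\<close>
    fix K assume K: "K \<in> extensional real_bm_polys \<and> linear_functional_on real_bm_polys K \<and>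
      L1_continuous_on W real_bm_polys K \<and> (\<forall>h\<in>rational_bm_polys. K h = L h)"
    show "K = L'"
    proof (rule extensionalityI)
      show "K \<in> extensional real_bm_polys" using K by simp
      show "L' \<in> extensional real_bm_polys" by (simp add: L'_def)
      fix h assume h: "h \<in> real_bm_polys"
      obtain p where p: "approximates p h"
        using approximates_exists[OF real_int[OF h]] .
      have pP: "restrict (p n) Omega \<in> rational_bm_polys" for n
        by (rule P_iff[THEN iffD1]) (use p in \<open>auto simp: approximates_def\<close>)
      have "(\<lambda>n. K (restrict (p n) Omega)) \<longlonglongrightarrow> K h"
        unfolding tendsto_iff
      proof (intro allI impI)
        fix e :: real assume "0 < e"
        then obtain d where d: "0 < d"
          "\<And>g. g \<in> real_bm_polys \<Longrightarrow> (\<integral>\<omega>. \<bar>g \<omega> - h \<omega>\<bar> \<partial>W) < d \<Longrightarrow> \<bar>K g - K h\<bar> < e"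
          using K h unfolding L1_continuous_on_def by meson
        have "(\<integral>\<omega>. \<bar>restrict (p n) Omega \<omega> - h \<omega>\<bar> \<partial>W) = (\<integral>\<omega>. \<bar>p n \<omega> - h \<omega>\<bar> \<partial>W)" for n
          by (rule Bochner_Integration.integral_cong) auto
        then have "\<forall>\<^sub>F n in sequentially. (\<integral>\<omega>. \<bar>restrict (p n) Omega \<omega> - h \<omega>\<bar> \<partial>W) < d"
          using p d(1) unfolding approximates_def by (auto intro: order_tendstoD)
        then show "\<forall>\<^sub>F n in sequentially. dist (K (restrict (p n) Omega)) (K h) < e"
          unfolding dist_real_def
          by (rule eventually_mono) (rule d(2)[OF subsetD[OF sub pP]])
      qed
      moreover have "K (restrict (p n) Omega) = l (p n)" for n
        using K pP by (simp add: l_def)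
      ultimately have "(\<lambda>n. l (p n)) \<longlonglongrightarrow> K h" by simp
      then show "K h = L' h"
        using L1_extension_tendsto[OF real_int[OF h] p] LIMSEQ_unique by (simp add: L'_L1_extension h)
    qed
  qed
  show ?thesis
    by (rule conjI[OF _ part2], rule exI[of _ representing_measure], rule exI[of _ coord_filtration],
        rule exI[of _ "\<lambda>t \<omega>. \<omega> t"], simp only: \<open>c = 1\<close> mult_1_left, rule part1)
qed

end
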